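(* 2-Union Independent Set is solvable in $O(2^{c_\exists}\cdot n)$ time when at least one input interval graph is $c_\exists$-compact, where $n$ is the number of vertices.
   Context: 2-Union Independent Set: given two interval graphs $G_1=(V,E_1)$, $G_2=(V,E_2)$ on the same vertex set and a natural number $k$, decide whether $G=(V,E_1\cup E_2)$ has an independent set of size $k$. $n=|V|$. An interval graph is the intersection graph of closed intervals on the real line. An interval representation is $c$-compact if the start and end points of all intervals lie in $\{1,\dots,c\}$ and the intervals are sorted by increasing start points; an interval graph is $c$-compact if it has a $c$-compact interval representation. $c_\exists$ denotes the minimum number such that at least one of $G_1,G_2$ is $c_\exists$-compact. Each input graph is assumed to be given by a $c$-compact interval representation for the minimum possible $c$ (for that graph). *)

theory Defs
  imports Complex_Main
begin

section \<open>Interval graphs and compact representations\<close>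

text \<open>A graph is a vertex set together with a set of two-element edges. A representation is a list
  of triples (vertex, start point, end point), since compactness constrains the order in which the
  intervals are listed.\<close>

definition interval_representation :: "'v set \<Rightarrow> 'v set set \<Rightarrow> ('v \<times> real \<times> real) list \<Rightarrow> bool" where
  "interval_representation V E R \<longleftrightarrow>
     distinct (map fst R) \<and> fst ` set R = V \<and>
     (\<forall>(v, a, b) \<in> set R. a \<le> b) \<and>
     E = {{u, v} | u v a b c d. (u, a, b) \<in> set R \<and> (v, c, d) \<in> set R \<and> u \<noteq> v \<and>
                                {a..b} \<inter> {c..d} \<noteq> {}}"

definition interval_graph :: "'v set \<Rightarrow> 'v set set \<Rightarrow> bool" where
  "interval_graph V E \<longleftrightarrow> (\<exists>R. interval_representation V E R)"

definition compact_representation ::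
    "nat \<Rightarrow> 'v set \<Rightarrow> 'v set set \<Rightarrow> ('v \<times> nat \<times> nat) list \<Rightarrow> bool" where
  "compact_representation c V E R \<longleftrightarrow>
     interval_representation V E (map (\<lambda>(v, a, b). (v, real a, real b)) R) \<and>
     (\<forall>(v, a, b) \<in> set R. a \<in> {1..c} \<and> b \<in> {1..c}) \<and>
     sorted (map (\<lambda>(v, a, b). a) R)"

definition compact :: "nat \<Rightarrow> 'v set \<Rightarrow> 'v set set \<Rightarrow> bool" where
  "compact c V E \<longleftrightarrow> (\<exists>R. compact_representation c V E R)"

definition compactness :: "'v set \<Rightarrow> 'v set set \<Rightarrow> nat" where
  "compactness V E = (LEAST c. compact c V E)"

definition c_exists :: "'v set \<Rightarrow> 'v set set \<Rightarrow> 'v set set \<Rightarrow> nat" where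
  "c_exists V E1 E2 = (LEAST c. compact c V E1 \<or> compact c V E2)"

section \<open>2-Union Independent Set\<close>

definition independent_set :: "'v set \<Rightarrow> 'v set set \<Rightarrow> 'v set \<Rightarrow> bool" where
  "independent_set V E S \<longleftrightarrow> S \<subseteq> V \<and> (\<forall>u\<in>S. \<forall>v\<in>S. {u, v} \<notin> E)"

definition two_union_independent_set :: "'v set \<Rightarrow> 'v set set \<Rightarrow> 'v set set \<Rightarrow> nat \<Rightarrow> bool" where
  "two_union_independent_set V E1 E2 k \<longleftrightarrow>
     (\<exists>S. independent_set V (E1 \<union> E2) S \<and> card S = k)"

section \<open>Random access machines\<close>

text \<open>The uniform-cost RAM: every instruction takes one time step. The only arithmetic is addition
  and (truncated) subtraction; in particular there is no unit-cost multiplication, so numbers grow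
  by at most one bit per step. Registers are named by constants in the program, memory cells are
  addressed by register contents. A program halts when the program counter leaves it.\<close>

datatype instr =
    Const nat nat          \<comment> \<open>\<open>r\<^sub>i := m\<close>\<close>
  | Add nat nat nat        \<comment> \<open>\<open>r\<^sub>i := r\<^sub>j + r\<^sub>k\<close>\<close>
  | Sub nat nat nat        \<comment> \<open>\<open>r\<^sub>i := r\<^sub>j - r\<^sub>k\<close>\<close>
  | Load nat nat           \<comment> \<open>\<open>r\<^sub>i := mem[r\<^sub>j]\<close>\<close>
  | Store nat nat          \<comment> \<open>\<open>mem[r\<^sub>i] := r\<^sub>j\<close>\<close>
  | Jump nat               \<comment> \<open>\<open>goto l\<close>\<close>
  | Jump_Less nat nat nat  \<comment> \<open>\<open>if r\<^sub>i < r\<^sub>j then goto l\<close>\<close>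

type_synonym program = "instr list"

type_synonym config = "nat \<times> (nat \<Rightarrow> nat) \<times> (nat \<Rightarrow> nat)"  \<comment> \<open>program counter, registers, memory\<close>

fun exec :: "instr \<Rightarrow> config \<Rightarrow> config" where
  "exec (Const i m) (pc, r, mem) = (Suc pc, r(i := m), mem)"
| "exec (Add i j k) (pc, r, mem) = (Suc pc, r(i := r j + r k), mem)"
| "exec (Sub i j k) (pc, r, mem) = (Suc pc, r(i := r j - r k), mem)"
| "exec (Load i j) (pc, r, mem) = (Suc pc, r(i := mem (r j)), mem)"
| "exec (Store i j) (pc, r, mem) = (Suc pc, r, mem(r i := r j))"
| "exec (Jump l) (pc, r, mem) = (l, r, mem)"
| "exec (Jump_Less i j l) (pc, r, mem) = (if r i < r j then l else Suc pc, r, mem)"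

definition halted :: "program \<Rightarrow> config \<Rightarrow> bool" where
  "halted P s \<longleftrightarrow> length P \<le> fst s"

definition step :: "program \<Rightarrow> config \<Rightarrow> config" where
  "step P s = (if halted P s then s else exec (P ! fst s) s)"

text \<open>The input occupies the memory cells from address 0 on; all else is initially 0.\<close>

definition initial :: "nat list \<Rightarrow> config" where
  "initial xs = (0, \<lambda>_. 0, \<lambda>a. if a < length xs then xs ! a else 0)"

text \<open>Halted configurations are fixed by \<open>step\<close>, so \<open>t\<close> is an upper bound on the running time. The
  answer is left in register 0.\<close>

definition decides_within :: "program \<Rightarrow> nat list \<Rightarrow> bool \<Rightarrow> nat \<Rightarrow> bool" where
  "decides_within P xs answer t \<longleftrightarrow>
     (case (step P ^^ t) (initial xs) of (pc, r, mem) \<Rightarrow>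
        halted P (pc, r, mem) \<and> r 0 = (if answer then 1 else 0))"

section \<open>Input encoding\<close>

definition encode_representation :: "(nat \<times> nat \<times> nat) list \<Rightarrow> nat list" where
  "encode_representation R = concat (map (\<lambda>(v, a, b). [v, a, b]) R)"

definition encode ::
    "nat \<Rightarrow> nat \<Rightarrow> (nat \<times> nat \<times> nat) list \<Rightarrow> (nat \<times> nat \<times> nat) list \<Rightarrow> nat list" where
  "encode n k R1 R2 = [n, k] @ encode_representation R1 @ encode_representation R2"

end

theory Submission
  imports Defs
begin

text \<open>
  Intervals of the graph of smaller compactness \<open>c\<close> are read as colour sets: an interval
  \<open>[a, b]\<close> occupies the bits \<open>a, \<dots>, b\<close> of a colour mask below \<open>2 ^ Suc c\<close> (bit 0 is idle). Sweeping over the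
  positions \<open>p\<close> of the other graph, one maintains for every mask \<open>C\<close> the largest set of intervals that
  end before \<open>p\<close>, are pairwise disjoint in both representations and use only colours of \<open>C\<close>. An
  interval \<open>[p, e]\<close> updates row \<open>e + 1\<close> from row \<open>p\<close>, and moving on to \<open>p + 1\<close> merges row \<open>p\<close> into row
  \<open>p + 1\<close>. Each of these \<open>2n\<close> steps costs \<open>O(2 ^ c)\<close>: there are at most \<open>n\<close> positions because
  ranking by start points makes every graph \<open>n\<close>-compact, and no bit operations are needed because the masks
  avoiding \<open>[a, b]\<close> are exactly \<open>h * 2 ^ (b + 1) + l\<close> with \<open>l < 2 ^ a\<close>.
\<close>

section \<open>Structured code with running times\<close>

text \<open>A row \<open>q > p\<close> may stay incomplete because intervals arrive in order of
  start points. When \<open>[p, e]\<close> is added, every earlier interval disjoint from it ends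
  before \<open>p\<close>, so \<open>[p, e]\<close> is the unique last one and only row
  \<open>e + 1\<close> has to learn of it. Updating all later rows would cost another factor
  \<open>n\<close>; the merges close the gap as \<open>p\<close> advances. The entry for mask
  \<open>C\<close> in row \<open>q\<close> has offset \<open>C * (n + 2) + q\<close>. Adding the
  colours of an interval and changing the row is then a constant shift of addresses, so both kinds
  of step are one operation: relax each target by the source at a fixed distance, plus 1 or plus 0.
  On a machine without multiplication the shift comes from a table of \<open>2 ^ j * (n + 2)\<close>
  built by doubling. For \<open>[a, b]\<close> there are \<open>2 ^ (c - b)\<close> values of
  \<open>h\<close> and \<open>2 ^ a\<close> values of \<open>l\<close>, together at most
  \<open>2 ^ c\<close> sources. Untouched memory is 0, the size of the empty packing, so the table
  is correct before the first step.\<close>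

type_synonym code = "nat \<Rightarrow> program"

definition located :: "program \<Rightarrow> nat \<Rightarrow> program \<Rightarrow> bool" where
  "located P l xs \<longleftrightarrow> (\<exists>ys zs. P = ys @ xs @ zs \<and> length ys = l)"

lemma located_appendD:
  assumes "located P l (xs @ ys)"
  shows "located P l xs" "located P (l + length xs) ys"
proof -
  obtain as bs where P: "P = as @ (xs @ ys) @ bs" "length as = l"
    using assms by (auto simp: located_def)
  show "located P l xs"
    unfolding located_def using P by (intro exI[of _ as] exI[of _ "ys @ bs"]) simp
  show "located P (l + length xs) ys"
    unfolding located_def using P by (intro exI[of _ "as @ xs"] exI[of _ bs]) simp
qed

lemma located_ConsD: "located P l (x # xs) \<Longrightarrow> located P (Suc l) xs"
  using located_appendD(2)[of P l "[x]" xs] by simp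

lemma step_located: "located P l (x # xs) \<Longrightarrow> step P (l, r, m) = exec x (l, r, m)"
  by (auto simp: located_def step_def halted_def nth_append)

text \<open>Total correctness with a time budget. Jump targets are absolute, so code depends on its
  load address; quantifying over the surrounding program lets pieces be verified in isolation.
  Control always leaves at the end of the piece, so \<open>Q\<close> speaks of registers and memory
  only.\<close>

definition wp :: "code \<Rightarrow> nat \<Rightarrow> ((nat \<Rightarrow> nat) \<Rightarrow> (nat \<Rightarrow> nat) \<Rightarrow> bool) \<Rightarrow>
    (nat \<Rightarrow> nat) \<Rightarrow> (nat \<Rightarrow> nat) \<Rightarrow> bool" where
  "wp c t Q r m \<longleftrightarrow> (\<forall>P l. located P l (c l) \<longrightarrow>
     (\<exists>t' r' m'. t' \<le> t \<and> (step P ^^ t') (l, r, m) = (l + length (c l), r', m') \<and> Q r' m'))"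

lemma wpI:
  assumes "\<And>P l. located P l (c l) \<Longrightarrow>
    \<exists>t' r' m'. t' \<le> t \<and> (step P ^^ t') (l, r, m) = (l + length (c l), r', m') \<and> Q r' m'"
  shows "wp c t Q r m"
  using assms by (auto simp: wp_def)

lemma wpE:
  assumes "wp c t Q r m" "located P l (c l)"
  obtains t' r' m' where "t' \<le> t" "(step P ^^ t') (l, r, m) = (l + length (c l), r', m')" "Q r' m'"
  using assms unfolding wp_def by blast

lemma wp_mono:
  assumes "wp c t Q r m" "t \<le> t'" "\<And>r m. Q r m \<Longrightarrow> Q' r m"
  shows "wp c t' Q' r m"
proof (rule wpI)
  fix P l assume "located P l (c l)"
  with assms(1) obtain u r' m' where "u \<le> t" "(step P ^^ u) (l, r, m) = (l + length (c l), r', m')" "Q r' m'"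
    by (rule wpE)
  then show "\<exists>t'' r' m'. t'' \<le> t' \<and> (step P ^^ t'') (l, r, m) = (l + length (c l), r', m') \<and> Q' r' m'"
    using assms(2,3) by (intro exI[of _ u] exI[of _ r'] exI[of _ m']) simp
qed

lemma step_trans:
  "(step P ^^ t) s = s' \<Longrightarrow> (step P ^^ u) s' = s'' \<Longrightarrow> (step P ^^ (u + t)) s = s''"
  by (simp add: funpow_add)

lemma step_Suc: "step P s = s' \<Longrightarrow> (step P ^^ t) s' = s'' \<Longrightarrow> (step P ^^ Suc t) s = s''"
  by (simp add: funpow_swap1)

fun straight :: "instr \<Rightarrow> bool" where
  "straight (Jump _) = False"
| "straight (Jump_Less _ _ _) = False"
| "straight _ = True"

definition block :: "program \<Rightarrow> code" where
  "block xs = (\<lambda>_. xs)"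

definition seq :: "code \<Rightarrow> code \<Rightarrow> code"  (infixr ";;" 60) where
  "c ;; d = (\<lambda>l. c l @ d (l + length (c l)))"

definition cond :: "nat \<Rightarrow> nat \<Rightarrow> code \<Rightarrow> code \<Rightarrow> code" where
  "cond i j c d = (\<lambda>l. let ys = d (Suc l); l' = l + length ys + 2; xs = c l' in
     Jump_Less i j l' # ys @ Jump (l' + length xs) # xs)"

definition loop :: "nat \<Rightarrow> nat \<Rightarrow> code \<Rightarrow> code" where
  "loop i j c = (\<lambda>l. let xs = c (l + 2) in
     Jump_Less i j (l + 2) # Jump (l + length xs + 3) # xs @ [Jump l])"

lemma straight_exec:
  assumes "straight x"
  shows "exec x (l, s) = (Suc l, snd (exec x (0, s)))"
  using assms by (cases s; cases x) auto

text \<open>Straight instructions treat registers and memory independently of the program counter. A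
  block can therefore be evaluated from any counter \<open>k\<close>, in particular from 0, where
  the simplifier runs it symbolically.\<close>

lemma fold_exec_block:
  assumes "list_all straight xs" "located P l xs"
  shows "(step P ^^ length xs) (l, s) = (l + length xs, snd (fold exec xs (k, s)))"
  using assms
proof (induction xs arbitrary: l s k)
  case Nil
  then show ?case by simp
next
  case (Cons x xs)
  have x: "straight x" and xs: "list_all straight xs" using Cons.prems by auto
  define s' where "s' = snd (exec x (0, s))"
  have e: "exec x (q, s) = (Suc q, s')" for q
    using straight_exec[OF x, of q s] by (simp add: s'_def)
  have "step P (l, s) = (Suc l, s')"
    using step_located[OF Cons.prems(2)] e by (cases s) auto
  moreover have "(step P ^^ length xs) (Suc l, s') = (Suc l + length xs, snd (fold exec xs (Suc k, s')))"
    by (rule Cons.IH[OF xs located_ConsD[OF Cons.prems(2)]])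
  ultimately have "(step P ^^ Suc (length xs)) (l, s) = (Suc l + length xs, snd (fold exec xs (Suc k, s')))"
    by (rule step_Suc)
  then show ?case by (simp add: e)
qed

lemma wp_block:
  assumes "list_all straight xs" "length xs \<le> t"
    "case fold exec xs (0, r, m) of (_, r', m') \<Rightarrow> Q r' m'"
  shows "wp (block xs) t Q r m"
proof (rule wpI)
  fix P l assume "located P l (block xs l)"
  then have "located P l xs" by (simp add: block_def)
  from fold_exec_block[OF assms(1) this, of "(r, m)" 0] assms(2,3)
  show "\<exists>t' r' m'. t' \<le> t \<and> (step P ^^ t') (l, r, m) = (l + length (block xs l), r', m') \<and> Q r' m'"
    by (intro exI[of _ "length xs"]) (auto simp: block_def split: prod.splits)
qed

text \<open>The postcondition of the first piece is the \<open>wp\<close> of the second, so no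
  intermediate assertion has to be named.\<close>

lemma wp_seq:
  assumes "wp c t (wp d u Q) r m" "t + u \<le> v"
  shows "wp (c ;; d) v Q r m"
proof (rule wpI)
  fix P l assume "located P l ((c ;; d) l)"
  then have c: "located P l (c l)" and d: "located P (l + length (c l)) (d (l + length (c l)))"
    by (auto simp: seq_def dest: located_appendD)
  obtain t' r' m' where 1: "t' \<le> t" "(step P ^^ t') (l, r, m) = (l + length (c l), r', m')" "wp d u Q r' m'"
    using wpE[OF assms(1) c] by metis
  obtain u' r'' m'' where 2: "u' \<le> u" "(step P ^^ u') (l + length (c l), r', m') =
      (l + length (c l) + length (d (l + length (c l))), r'', m'')" "Q r'' m''"
    using wpE[OF 1(3) d] by metis
  show "\<exists>t' r' m'. t' \<le> v \<and> (step P ^^ t') (l, r, m) = (l + length ((c ;; d) l), r', m') \<and> Q r' m'"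
    using step_trans[OF 1(2) 2(2)] 1(1) 2(1,3) assms(2)
    by (intro exI[of _ "u' + t'"] exI[of _ r''] exI[of _ m'']) (simp add: seq_def)
qed

lemma wp_cond:
  assumes "r i < r j \<Longrightarrow> wp c t Q r m" "\<not> r i < r j \<Longrightarrow> wp d t Q r m" "t + 2 \<le> u"
  shows "wp (cond i j c d) u Q r m"
proof (rule wpI)
  fix P l assume loc: "located P l (cond i j c d l)"
  define ys l' xs where "ys = d (Suc l)" and "l' = l + length ys + 2" and "xs = c l'"
  have code: "cond i j c d l = Jump_Less i j l' # ys @ Jump (l' + length xs) # xs"
    by (simp add: cond_def ys_def l'_def xs_def Let_def)
  have first: "step P (l, r, m) = (if r i < r j then l' else Suc l, r, m)"
    using step_located[OF loc[unfolded code]] by simp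
  have loc1: "located P (Suc l) (ys @ Jump (l' + length xs) # xs)"
    using located_ConsD[OF loc[unfolded code]] .
  have loc_d: "located P (Suc l) (d (Suc l))"
    using located_appendD(1)[OF loc1] by (simp add: ys_def)
  have loc2: "located P (Suc l + length ys) (Jump (l' + length xs) # xs)"
    using located_appendD(2)[OF loc1] .
  have loc_c: "located P l' (c l')"
    using located_ConsD[OF loc2] by (simp add: l'_def xs_def)
  have len: "l + length (cond i j c d l) = l' + length xs"
    by (simp add: code l'_def)
  show "\<exists>t' r' m'. t' \<le> u \<and> (step P ^^ t') (l, r, m) = (l + length (cond i j c d l), r', m') \<and> Q r' m'"
  proof (cases "r i < r j")
    case True
    obtain t' r' m' where 1: "t' \<le> t" "(step P ^^ t') (l', r, m) = (l' + length (c l'), r', m')" "Q r' m'"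
      using wpE[OF assms(1)[OF True] loc_c] by metis
    have "step P (l, r, m) = (l', r, m)" using first True by simp
    from step_Suc[OF this 1(2)] show ?thesis
      unfolding len using 1 assms(3)
      by (intro exI[of _ "Suc t'"] exI[of _ r'] exI[of _ m']) (simp add: xs_def)
  next
    case False
    obtain t' r' m' where 1: "t' \<le> t" "(step P ^^ t') (Suc l, r, m) = (Suc l + length ys, r', m')" "Q r' m'"
      using wpE[OF assms(2)[OF False] loc_d] unfolding ys_def by metis
    have "step P (l, r, m) = (Suc l, r, m)" using first False by simp
    from step_Suc[OF this 1(2)] have 2: "(step P ^^ Suc t') (l, r, m) = (Suc l + length ys, r', m')" .
    have "(step P ^^ 1) (Suc l + length ys, r', m') = (l' + length xs, r', m')"
      using step_located[OF loc2, of r' m'] by simp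
    from step_trans[OF 2 this] show ?thesis
      unfolding len using 1 assms(3)
      by (intro exI[of _ "1 + Suc t'"] exI[of _ r'] exI[of _ m']) simp
  qed
qed

text \<open>The invariant counts iterations, and \<open>guard\<close> makes the test succeed exactly
  for the first \<open>N\<close> of them. Each iteration pays 2 extra steps (test and jump back),
  and leaving pays 2 more (failed test and jump out).\<close>

lemma wp_loop:
  assumes init: "I 0 r m"
    and body: "\<And>k r m. k < N \<Longrightarrow> I k r m \<Longrightarrow> wp c t (I (Suc k)) r m"
    and guard: "\<And>k r m. k \<le> N \<Longrightarrow> I k r m \<Longrightarrow> r i < r j \<longleftrightarrow> k < N"
    and post: "\<And>r m. I N r m \<Longrightarrow> Q r m"
    and time: "N * (t + 2) + 2 \<le> u"
  shows "wp (loop i j c) u Q r m"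
proof (rule wpI)
  fix P l assume loc: "located P l (loop i j c l)"
  define xs where "xs = c (l + 2)"
  have code: "loop i j c l = Jump_Less i j (l + 2) # Jump (l + length xs + 3) # xs @ [Jump l]"
    by (simp add: loop_def xs_def Let_def)
  have first: "step P (l, r, m) = (if r i < r j then l + 2 else Suc l, r, m)" for r m
    using step_located[OF loc[unfolded code]] by simp
  have loc1: "located P (Suc l) (Jump (l + length xs + 3) # xs @ [Jump l])"
    using located_ConsD[OF loc[unfolded code]] .
  have loc2: "located P (l + 2) (xs @ [Jump l])"
    using located_ConsD[OF loc1] by simp
  have loc_c: "located P (l + 2) (c (l + 2))"
    using located_appendD(1)[OF loc2] by (simp add: xs_def)
  have loc3: "located P (l + 2 + length xs) [Jump l]"
    using located_appendD(2)[OF loc2] .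
  have len: "l + length (loop i j c l) = l + length xs + 3" by (simp add: code)
  have iter: "\<exists>t' r' m'. t' \<le> k * (t + 2) \<and> (step P ^^ t') (l, r, m) = (l, r', m') \<and> I k r' m'"
    if "k \<le> N" for k
    using that
  proof (induction k)
    case 0
    show ?case using init by (intro exI[of _ 0] exI[of _ r] exI[of _ m]) simp
  next
    case (Suc k)
    then obtain t' r' m' where 1: "t' \<le> k * (t + 2)" "(step P ^^ t') (l, r, m) = (l, r', m')" "I k r' m'"
      by auto
    have k: "k < N" using Suc.prems by simp
    have "step P (l, r', m') = (l + 2, r', m')" using first guard[OF _ 1(3)] k by simp
    then have 2: "(step P ^^ 1) (l, r', m') = (l + 2, r', m')" by simp
    obtain u r'' m'' where 3: "u \<le> t" "(step P ^^ u) (l + 2, r', m') = (l + 2 + length xs, r'', m'')"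
        "I (Suc k) r'' m''"
      using wpE[OF body[OF k 1(3)] loc_c] unfolding xs_def by metis
    have 4: "(step P ^^ 1) (l + 2 + length xs, r'', m'') = (l, r'', m'')"
      using step_located[OF loc3, of r'' m''] by simp
    have "(step P ^^ (1 + (u + (1 + t')))) (l, r, m) = (l, r'', m'')"
      by (rule step_trans[OF step_trans[OF step_trans[OF 1(2) 2] 3(2)] 4])
    then show ?case using 1(1) 3(1,3)
      by (intro exI[of _ "1 + (u + (1 + t'))"] exI[of _ r''] exI[of _ m'']) simp
  qed
  obtain t' r' m' where 1: "t' \<le> N * (t + 2)" "(step P ^^ t') (l, r, m) = (l, r', m')" "I N r' m'"
    using iter[of N] by auto
  have "step P (l, r', m') = (Suc l, r', m')" using first guard[OF _ 1(3)] by simp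
  moreover have "(step P ^^ 1) (Suc l, r', m') = (l + length xs + 3, r', m')"
    using step_located[OF loc1, of r' m'] by simp
  ultimately have "(step P ^^ Suc 1) (l, r', m') = (l + length xs + 3, r', m')" by (rule step_Suc)
  from step_trans[OF 1(2) this]
  show "\<exists>t' r' m'. t' \<le> u \<and> (step P ^^ t') (l, r, m) = (l + length (loop i j c l), r', m') \<and> Q r' m'"
    unfolding len using 1 time post[OF 1(3)]
    by (intro exI[of _ "Suc 1 + t'"] exI[of _ r'] exI[of _ m']) simp
qed

lemma wp_decides:
  assumes "wp c t (\<lambda>r m. r 0 = (if answer then 1 else 0)) (\<lambda>_. 0) (snd (snd (initial xs)))"
    and "t \<le> u"
  shows "decides_within (c 0) xs answer u"
proof -
  have "located (c 0) 0 (c 0)" by (auto simp: located_def)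
  from wpE[OF assms(1) this] obtain t' r' m' where
    1: "t' \<le> t" "(step (c 0) ^^ t') (initial xs) = (length (c 0), r', m')"
      "r' 0 = (if answer then 1 else 0)"
    by (auto simp: initial_def)
  have "step (c 0) (length (c 0), r', m') = (length (c 0), r', m')"
    by (simp add: step_def halted_def)
  then have "(step (c 0) ^^ k) (length (c 0), r', m') = (length (c 0), r', m')" for k
    by (induction k) auto
  from step_trans[OF 1(2) this[of "u - t'"]] 1 assms(2)
  show ?thesis by (simp add: decides_within_def halted_def)
qed

section \<open>Dynamic programming over positions and colour sets\<close>

definition colour_mask :: "nat \<Rightarrow> nat \<Rightarrow> nat" where
  "colour_mask a b = 2 ^ Suc b - 2 ^ a"

lemma bit_colour_mask:
  assumes "a \<le> b"
  shows "bit (colour_mask a b) j \<longleftrightarrow> a \<le> j \<and> j \<le> b"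
proof -
  have "colour_mask a b = push_bit a (mask (Suc b - a))"
    using assms by (simp add: colour_mask_def push_bit_eq_mult mask_eq_exp_minus_1 diff_mult_distrib
        flip: power_add)
  then show ?thesis using assms by (auto simp: bit_push_bit_iff bit_mask_iff)
qed

text \<open>\<open>l\<close> fills only digits below \<open>a\<close> and \<open>h\<close> only
  digits above \<open>b\<close>, so the addition has no carries and is a bitwise
  \<open>or\<close>.\<close>

lemma bit_block:
  fixes h l :: nat
  assumes "l < 2 ^ a" "a \<le> b"
  shows "bit (h * 2 ^ Suc b + l) j \<longleftrightarrow> (j < a \<and> bit l j) \<or> (b < j \<and> bit h (j - Suc b))"
proof -
  have l: "take_bit a l = l" using assms(1) by (simp add: take_bit_nat_eq_self)
  have bl: "bit l j \<Longrightarrow> j < a" for j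
    using bit_take_bit_iff[of a l j] l by simp
  have "h * 2 ^ Suc b + l = or (push_bit (Suc b) h) l"
    unfolding push_bit_eq_mult[symmetric]
    by (rule disjunctive_add) (use assms(2) bl in \<open>fastforce simp: bit_push_bit_iff\<close>)
  then show ?thesis
    using bl assms(2) by (auto simp: bit_or_iff bit_push_bit_iff Suc_le_eq simp del: push_bit_Suc power_Suc)
qed

lemma bit_block_mask:
  fixes h l :: nat
  assumes "l < 2 ^ a" "a \<le> b"
  shows "bit (h * 2 ^ Suc b + l + colour_mask a b) j \<longleftrightarrow>
    bit (h * 2 ^ Suc b + l) j \<or> (a \<le> j \<and> j \<le> b)"
proof -
  have "h * 2 ^ Suc b + l + colour_mask a b = or (h * 2 ^ Suc b + l) (colour_mask a b)"
    by (rule disjunctive_add) (auto simp add: bit_block[OF assms] bit_colour_mask[OF assms(2)] simp del: power_Suc)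
  then show ?thesis
    by (simp only: bit_or_iff bit_colour_mask[OF assms(2)])
qed

text \<open>Cutting the digits \<open>a\<close> to \<open>b\<close>, all of them set, out of
  \<open>x\<close> leaves a quotient \<open>h\<close> and a remainder \<open>l\<close>. Together
  with \<open>bit_block_mask\<close> this enumerates the masks containing an interval by arithmetic
  alone.\<close>

lemma block_mask_exists:
  fixes x :: nat
  assumes "\<And>j. a \<le> j \<Longrightarrow> j \<le> b \<Longrightarrow> bit x j" "a \<le> b"
  obtains h l where "l < 2 ^ a" "x = h * 2 ^ Suc b + l + colour_mask a b"
proof -
  define h l where "h = x div 2 ^ Suc b" and "l = take_bit a x"
  have l: "l < 2 ^ a" by (simp add: l_def)
  have "x = h * 2 ^ Suc b + l + colour_mask a b"
  proof (rule bit_eqI)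
    fix j
    show "bit x j \<longleftrightarrow> bit (h * 2 ^ Suc b + l + colour_mask a b) j"
      unfolding bit_block_mask[OF l assms(2)] bit_block[OF l assms(2)]
      unfolding h_def l_def drop_bit_eq_div[symmetric] bit_drop_bit_eq bit_take_bit_iff
      using assms by (auto simp: not_less_eq_eq not_less)
  qed
  with l that show ?thesis by blast
qed

section \<open>The sweep recurrence and its invariant\<close>

locale interval_dp =
  fixes n c :: nat and s e a b :: "nat \<Rightarrow> nat"
  assumes pos: "\<And>i. i < n \<Longrightarrow> 1 \<le> s i \<and> s i \<le> e i \<and> e i \<le> n"
    and col: "\<And>i. i < n \<Longrightarrow> 1 \<le> a i \<and> a i \<le> b i \<and> b i \<le> c"
    and sorted_s: "\<And>i j. i \<le> j \<Longrightarrow> j < n \<Longrightarrow> s i \<le> s j"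
begin

definition packing :: "nat \<Rightarrow> nat \<Rightarrow> nat set \<Rightarrow> bool" where
  "packing i C S \<longleftrightarrow> S \<subseteq> {..<i} \<and>
     (\<forall>x\<in>S. \<forall>y\<in>S. x \<noteq> y \<longrightarrow> (e x < s y \<or> e y < s x) \<and> (b x < a y \<or> b y < a x)) \<and>
     (\<forall>x\<in>S. \<forall>j. a x \<le> j \<and> j \<le> b x \<longrightarrow> bit C j)"

text \<open>The state of the sweep at position \<open>p\<close> after \<open>i\<close> intervals. Row \<open>p\<close> is final, whereas a later row
  \<open>q\<close> need only account for the packings whose last end point is exactly \<open>q - 1\<close>.\<close>

definition table :: "nat \<Rightarrow> nat \<Rightarrow> (nat \<Rightarrow> nat \<Rightarrow> nat) \<Rightarrow> bool" where
  "table p i T \<longleftrightarrow> 1 \<le> p \<and> p \<le> Suc n \<and> i \<le> n \<and>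
     (\<forall>j<n. (j < i \<longrightarrow> s j \<le> p) \<and> (i \<le> j \<longrightarrow> p \<le> s j)) \<and>
     (\<forall>q C. p \<le> q \<longrightarrow> q \<le> Suc n \<longrightarrow> C < 2 ^ Suc c \<longrightarrow>
        (\<exists>S. packing i C S \<and> (\<forall>x\<in>S. e x < q) \<and> card S = T q C) \<and>
        (\<forall>S. packing i C S \<longrightarrow> (\<forall>x\<in>S. e x < q) \<longrightarrow> q = p \<or> (\<exists>x\<in>S. Suc (e x) = q) \<longrightarrow>
           card S \<le> T q C))"

lemma table_sound:
  assumes "table p i T" "p \<le> q" "q \<le> Suc n" "C < 2 ^ Suc c"
  shows "\<exists>S. packing i C S \<and> (\<forall>x\<in>S. e x < q) \<and> card S = T q C"
  using assms unfolding table_def by blast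

lemma table_complete:
  assumes "table p i T" "p \<le> q" "q \<le> Suc n" "C < 2 ^ Suc c"
    "packing i C S" "\<forall>x\<in>S. e x < q" "q = p \<or> (\<exists>x\<in>S. Suc (e x) = q)"
  shows "card S \<le> T q C"
  using assms unfolding table_def by blast

lemma packing_finite: "packing i C S \<Longrightarrow> finite S"
  unfolding packing_def using finite_subset by blast

lemma table_init: "table 1 0 (\<lambda>_ _. 0)"
  using pos by (auto simp: table_def packing_def)

text \<open>A packing that ends before \<open>p + 1\<close> either has an interval ending exactly at
  \<open>p\<close>, covered by the old row \<open>p + 1\<close>, or ends before \<open>p\<close>,
  covered by row \<open>p\<close>. Their maximum makes row \<open>p + 1\<close> final.\<close>

lemma table_propagate:
  assumes T: "table p i T" and p: "p \<le> n" "i < n \<Longrightarrow> p < s i"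
    and T': "\<And>q C. q \<le> Suc n \<Longrightarrow> C < 2 ^ Suc c \<Longrightarrow>
      T' q C = (if q = Suc p then max (T q C) (T p C) else T q C)"
  shows "table (Suc p) i T'"
proof -
  have range: "\<forall>j<n. (j < i \<longrightarrow> s j \<le> Suc p) \<and> (i \<le> j \<longrightarrow> Suc p \<le> s j)"
  proof (intro allI impI conjI)
    fix j assume "j < n"
    { assume "j < i" with T \<open>j < n\<close> show "s j \<le> Suc p" by (auto simp: table_def intro: le_SucI) }
    { assume "i \<le> j" with \<open>j < n\<close> p(2) sorted_s[of i j] show "Suc p \<le> s j" by linarith }
  qed
  have sound: "\<exists>S. packing i C S \<and> (\<forall>x\<in>S. e x < q) \<and> card S = T' q C"
    if q: "Suc p \<le> q" "q \<le> Suc n" and C: "C < 2 ^ Suc c" for q C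
  proof (cases "q = Suc p \<and> T q C < T p C")
    case True
    obtain S where "packing i C S" "\<forall>x\<in>S. e x < p" "card S = T p C"
      using table_sound[OF T order_refl _ C] p(1) by auto
    then show ?thesis using True T'[OF q(2) C] by (intro exI[of _ S]) (auto simp: max_def)
  next
    case False
    have "\<exists>S. packing i C S \<and> (\<forall>x\<in>S. e x < q) \<and> card S = T q C"
      using table_sound[OF T Suc_leD[OF q(1)] q(2) C] by blast
    then show ?thesis using False T'[OF q(2) C] by (auto simp: max_def split: if_splits)
  qed
  have complete: "card S \<le> T' q C"
    if q: "Suc p \<le> q" "q \<le> Suc n" and C: "C < 2 ^ Suc c" and S: "packing i C S" "\<forall>x\<in>S. e x < q"
      and last: "q = Suc p \<or> (\<exists>x\<in>S. Suc (e x) = q)" for q C S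
  proof (cases "\<exists>x\<in>S. Suc (e x) = q")
    case True
    then have "card S \<le> T q C"
      using table_complete[OF T Suc_leD[OF q(1)] q(2) C S] by blast
    then show ?thesis using T'[OF q(2) C] by auto
  next
    case False
    with last have q': "q = Suc p" by auto
    then have "\<forall>x\<in>S. e x < p" using S(2) False by (metis less_Suc_eq)
    then have "card S \<le> T p C"
      using table_complete[OF T order_refl _ C S(1)] p(1) by auto
    then show ?thesis using T'[OF q(2) C] q' by auto
  qed
  show ?thesis
    using T p range sound complete unfolding table_def by auto
qed

text \<open>The invariant forces \<open>s i = p\<close>. Earlier intervals start no later than
  \<open>p \<le> e i\<close>, so those disjoint from \<open>i\<close> end before \<open>p\<close>. A
  packing containing \<open>i\<close> is thus \<open>i\<close> plus a packing of row
  \<open>p\<close> that avoids its colours, and its last end point is \<open>e i\<close>.\<close>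

lemma table_process:
  assumes T: "table p i T" and i: "i < n" "s i \<le> p"
    and T': "\<And>q C. q \<le> Suc n \<Longrightarrow> C < 2 ^ Suc c \<Longrightarrow>
      T' q C = (if q = Suc (e i) \<and> (\<forall>j. a i \<le> j \<and> j \<le> b i \<longrightarrow> bit C j)
                then max (T q C) (Suc (T p (C - colour_mask (a i) (b i)))) else T q C)"
  shows "table p (Suc i) T'"
proof -
  have sp: "s i = p" using T i unfolding table_def by (meson order_antisym order_refl)
  have pn: "p \<le> n" "1 \<le> p" using pos[OF i(1)] sp by auto
  have ab: "a i \<le> b i" using col[OF i(1)] by simp
  have ei: "p \<le> e i" "e i \<le> n" using pos[OF i(1)] sp by auto
  have range: "\<forall>j<n. (j < Suc i \<longrightarrow> s j \<le> p) \<and> (Suc i \<le> j \<longrightarrow> p \<le> s j)"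
    using T sp unfolding table_def by (auto simp: less_Suc_eq)
  have mono: "packing (Suc i) C S" if "packing i C S" for C S
    using that unfolding packing_def by auto
  \<comment> \<open>All digits of the mask are set in \<open>C\<close>, so the subtraction never
    borrows and acts as set difference.\<close>
  have split: "C - colour_mask (a i) (b i) < 2 ^ Suc c \<and>
      (\<forall>j. bit (C - colour_mask (a i) (b i)) j \<longleftrightarrow> bit C j \<and> \<not> (a i \<le> j \<and> j \<le> b i))"
    if full: "\<forall>j. a i \<le> j \<and> j \<le> b i \<longrightarrow> bit C j" and C: "C < 2 ^ Suc c" for C
  proof -
    obtain h l where l: "l < 2 ^ a i" and Ceq: "C = h * 2 ^ Suc (b i) + l + colour_mask (a i) (b i)"
      using block_mask_exists[OF _ ab, of C] full by blast
    have "C - colour_mask (a i) (b i) = h * 2 ^ Suc (b i) + l" using Ceq by simp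
    moreover have "bit C j \<longleftrightarrow> bit (h * 2 ^ Suc (b i) + l) j \<or> (a i \<le> j \<and> j \<le> b i)" for j
      unfolding Ceq using bit_block_mask[OF l ab] .
    ultimately show ?thesis
      using C bit_block[OF l ab, of h] by (auto simp del: power_Suc)
  qed
  have old: "s x \<le> p" if "x < i" for x
    using T i that unfolding table_def by auto
  have sound: "\<exists>S. packing (Suc i) C S \<and> (\<forall>x\<in>S. e x < q) \<and> card S = T' q C"
    if q: "p \<le> q" "q \<le> Suc n" and C: "C < 2 ^ Suc c" for q C
  proof (cases "T' q C = T q C")
    case True
    have "\<exists>S. packing i C S \<and> (\<forall>x\<in>S. e x < q) \<and> card S = T q C"
      using T C q unfolding table_def by auto
    then show ?thesis using True mono by metis
  next
    case False
    then have q': "q = Suc (e i)" and full: "\<forall>j. a i \<le> j \<and> j \<le> b i \<longrightarrow> bit C j"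
      and val: "T' q C = Suc (T p (C - colour_mask (a i) (b i)))"
      using T'[OF q(2) C] by (auto simp: max_def split: if_splits)
    define D where "D = C - colour_mask (a i) (b i)"
    have D: "D < 2 ^ Suc c" "\<And>j. bit D j \<longleftrightarrow> bit C j \<and> \<not> (a i \<le> j \<and> j \<le> b i)"
      using split[OF full C] by (auto simp: D_def)
    obtain S where S: "packing i D S" "\<forall>x\<in>S. e x < p" "card S = T p D"
      using table_sound[OF T order_refl _ D(1)] pn by auto
    have iS: "i \<notin> S" using S(1) by (auto simp: packing_def)
    have disj: "b x < a i \<or> b i < a x" if "x \<in> S" for x
    proof -
      have "x < n" using S(1) that i by (auto simp: packing_def)
      then have "a x \<le> b x" using col by simp
      show ?thesis
      proof (rule ccontr)
        assume "\<not> ?thesis"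
        \<comment> \<open>Overlapping colour intervals share the larger of their left ends, but that
          colour has been removed from \<open>D\<close>.\<close>
        then have "a x \<le> max (a i) (a x)" "max (a i) (a x) \<le> b x" "a i \<le> max (a i) (a x)" "max (a i) (a x) \<le> b i"
          using \<open>a x \<le> b x\<close> ab by auto
        with D(2) S(1) that show False unfolding packing_def by blast
      qed
    qed
    have "packing (Suc i) C (insert i S)"
      using S(1,2) disj sp full D(2) unfolding packing_def by auto
    moreover have "\<forall>x\<in>insert i S. e x < q" using S(2) q' ei by force
    moreover have "card (insert i S) = T' q C"
      using iS packing_finite[OF S(1)] S(3) val by (simp add: D_def)
    ultimately show ?thesis by blast
  qed
  have complete: "card S \<le> T' q C"
    if q: "p \<le> q" "q \<le> Suc n" and C: "C < 2 ^ Suc c" and S: "packing (Suc i) C S" "\<forall>x\<in>S. e x < q"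
      and last: "q = p \<or> (\<exists>x\<in>S. Suc (e x) = q)" for q C S
  proof (cases "i \<in> S")
    case False
    then have "packing i C S" using S(1) unfolding packing_def by (auto simp: less_Suc_eq)
    then have "card S \<le> T q C"
      using T C q S(2) last unfolding table_def by blast
    then show ?thesis using T'[OF q(2) C] by auto
  next
    case True
    define R where "R = S - {i}"
    have full: "\<forall>j. a i \<le> j \<and> j \<le> b i \<longrightarrow> bit C j" using True S(1) unfolding packing_def by blast
    define D where "D = C - colour_mask (a i) (b i)"
    have D: "D < 2 ^ Suc c" "\<And>j. bit D j \<longleftrightarrow> bit C j \<and> \<not> (a i \<le> j \<and> j \<le> b i)"
      using split[OF full C] by (auto simp: D_def)
    have early: "e x < p" and apart: "b x < a i \<or> b i < a x" and "x < i" if "x \<in> R" for x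
    proof -
      have x: "x \<in> S" "x \<noteq> i" "x < i" using that S(1) by (auto simp: R_def packing_def)
      then have "(e x < s i \<or> e i < s x) \<and> (b x < a i \<or> b i < a x)"
        using S(1) True unfolding packing_def by blast
      then show "e x < p" "b x < a i \<or> b i < a x" "x < i" using old[OF x(3)] ei sp x by auto
    qed
    have "packing i D R"
      unfolding packing_def
    proof (intro conjI)
      show "R \<subseteq> {..<i}" using \<open>\<And>x. x \<in> R \<Longrightarrow> x < i\<close> by auto
      show "\<forall>x\<in>R. \<forall>y\<in>R. x \<noteq> y \<longrightarrow> (e x < s y \<or> e y < s x) \<and> (b x < a y \<or> b y < a x)"
        using S(1) unfolding packing_def R_def by blast
      show "\<forall>x\<in>R. \<forall>j. a x \<le> j \<and> j \<le> b x \<longrightarrow> bit D j"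
      proof (intro ballI allI impI)
        fix x j assume x: "x \<in> R" "a x \<le> j \<and> j \<le> b x"
        then have "bit C j" using S(1) unfolding packing_def R_def by blast
        then show "bit D j" using apart[OF x(1)] x(2) D(2)[of j] by auto
      qed
    qed
    then have "card R \<le> T p D"
      using table_complete[OF T order_refl _ D(1)] pn early by auto
    moreover have "card S = Suc (card R)"
      unfolding R_def using packing_finite[OF S(1)] True by (metis card.remove)
    \<comment> \<open>Since \<open>p \<le> e i < q\<close>, the case \<open>q = p\<close> is out,
      and the interval ending at \<open>q - 1\<close> ends too late to lie in \<open>R\<close>; it
      must be \<open>i\<close>.\<close>
    moreover have "q = Suc (e i)"
    proof -
      have "e i < q" using S(2) True by blast
      with last ei obtain x where x: "x \<in> S" "Suc (e x) = q" by auto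
      then have "x \<notin> R" using early[of x] ei \<open>e i < q\<close> by auto
      with x show ?thesis by (auto simp: R_def)
    qed
    ultimately show ?thesis using T'[OF q(2) C] full by (simp add: D_def)
  qed
  show ?thesis
    using T i range sound complete unfolding table_def by auto
qed

text \<open>Every interval starts and ends within \<open>1\<close> to \<open>n\<close>, so at
  position \<open>n + 1\<close> none is left and row \<open>n + 1\<close> covers every
  packing.\<close>

lemma table_final:
  assumes "table (Suc n) i T"
  shows "i = n"
    and "\<exists>S. packing n (2 ^ Suc c - 1) S \<and> card S = T (Suc n) (2 ^ Suc c - 1)"
    and "packing n (2 ^ Suc c - 1) S \<Longrightarrow> card S \<le> T (Suc n) (2 ^ Suc c - 1)"
proof -
  show i: "i = n"
  proof (rule ccontr)
    assume "i \<noteq> n"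
    then have "i < n" "Suc n \<le> s i" using assms unfolding table_def by auto
    then show False using pos[of i] by simp
  qed
  have C: "(2::nat) ^ Suc c - 1 < 2 ^ Suc c" by simp
  show "\<exists>S. packing n (2 ^ Suc c - 1) S \<and> card S = T (Suc n) (2 ^ Suc c - 1)"
    using table_sound[OF assms order_refl order_refl C] i by blast
  show "card S \<le> T (Suc n) (2 ^ Suc c - 1)" if S: "packing n (2 ^ Suc c - 1) S"
  proof -
    have "\<forall>x\<in>S. e x < Suc n" using S pos unfolding packing_def by (meson le_imp_less_Suc lessThan_iff subsetD)
    then show ?thesis using table_complete[OF assms order_refl order_refl C] S i by blast
  qed
qed

end

section \<open>Updating table rows in memory\<close>

text \<open>\<open>A\<close> holds source addresses, and the target of each lies \<open>D\<close>
  cells further. All values are read from the old memory, so this is a simultaneous update; a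
  sequential loop realises it as long as no source is also a target.\<close>

definition relaxed :: "(nat \<Rightarrow> nat) \<Rightarrow> nat set \<Rightarrow> nat \<Rightarrow> nat \<Rightarrow> nat \<Rightarrow> nat" where
  "relaxed m A D d = (\<lambda>y. if y \<in> (\<lambda>x. x + D) ` A then max (m y) (m (y - D) + d) else m y)"

lemma relaxed_empty: "relaxed m {} D d = m"
  by (simp add: relaxed_def)

lemma relaxed_insert:
  assumes "x \<notin> (\<lambda>x. x + D) ` A"
  shows "relaxed m (insert x A) D d =
    (if relaxed m A D d (x + D) < m x + d then (relaxed m A D d)(x + D := m x + d) else relaxed m A D d)"
  using assms by (auto simp: relaxed_def fun_eq_iff max_def)

lemma relaxed_relaxed:
  assumes "\<And>x. x \<in> A' \<Longrightarrow> x \<notin> (\<lambda>x. x + D) ` A"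
  shows "relaxed (relaxed m A D d) A' D d = relaxed m (A \<union> A') D d"
proof -
  have "x + D \<notin> A'" if "x \<in> A" for x using assms that by blast
  with assms show ?thesis by (auto simp: relaxed_def fun_eq_iff)
qed

text \<open>Registers: 0 to 9 hold constants of the input, 17 is the address of the next interval, 21 the
  base of the table of masks \<open>2 ^ j * (n + 2)\<close>, 26 the base of the dynamic programming table, 27 the
  position, and those from 28 on are scratch. The entry in row \<open>q\<close> for mask \<open>C\<close> has offset
  \<open>C * (n + 2) + q\<close>, so register 5 (\<open>n + 2\<close>) is the stride within a row.\<close>

definition relax_row :: code where
  "relax_row = loop 39 38
     (block [Load 40 39, Add 40 40 35, Add 41 39 34, Load 42 41] ;;
      cond 42 40 (block [Store 41 40]) (block []) ;;
      block [Add 39 39 5])"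

text \<open>\<open>apart\<close> separates sources from targets, so every source still has its
  original value when it is read. An entry costs 8 steps and 2 of loop control.\<close>

lemma wp_relax_row:
  assumes r: "r 5 = W" "r 39 = x" "r 38 = x + N * W" "r 34 = D" "r 35 = d" and W: "0 < W"
    and apart: "\<And>i j. i < N \<Longrightarrow> j < N \<Longrightarrow> x + i * W \<noteq> x + j * W + D"
    and Q: "\<And>r'. (\<forall>i<39. r' i = r i) \<Longrightarrow> Q r' (relaxed m ((\<lambda>i. x + i * W) ` {..<N}) D d)"
    and t: "N * 10 + 2 \<le> t"
  shows "wp relax_row t Q r m"
proof -
  let ?A = "\<lambda>k. (\<lambda>i. x + i * W) ` {..<k}"
  let ?I = "\<lambda>k r' m'. (\<forall>i<39. r' i = r i) \<and> r' 39 = x + k * W \<and> m' = relaxed m (?A k) D d"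
  show ?thesis
  unfolding relax_row_def
  proof (rule wp_loop[where I = ?I and N = "N"])
  show "?I 0 r m" using r by (simp add: relaxed_empty)
  show "Q r' m'" if "?I N r' m'" for r' m' using Q that by auto
  show "r' 39 < r' 38 \<longleftrightarrow> k < N" if "k \<le> N" "?I k r' m'" for k r' m'
    using that r W by auto
  show "N * (8 + 2) + 2 \<le> t" using t by simp
  fix k r' m' assume k: "k < N" and I: "?I k r' m'"
  define y where "y = x + k * W"
  have y: "y \<notin> (\<lambda>x. x + D) ` ?A k" using apart k by (auto simp: y_def)
  have ins: "?A (Suc k) = insert y (?A k)" by (auto simp: y_def lessThan_Suc)
  have my: "m' y = m y" using y I by (simp add: relaxed_def)
  have upd: "relaxed m (?A (Suc k)) D d =
      (if m' (y + D) < m' y + d then m'(y + D := m' y + d) else m')"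
    unfolding ins relaxed_insert[OF y] my using I by simp
  have regs: "r' 39 = y" "r' 34 = D" "r' 35 = d" "r' 5 = W"
    using I r by (auto simp: y_def)
  have fin: "wp (block [Add 39 39 5]) 1 (?I (Suc k)) r'' m''"
    if "\<forall>i<39. r'' i = r i" "r'' 39 = y" "m'' = relaxed m (?A (Suc k)) D d" for r'' m''
    by (rule wp_block) (use that r in \<open>simp_all add: y_def\<close>)
  show "wp (block [Load 40 39, Add 40 40 35, Add 41 39 34, Load 42 41] ;;
      cond 42 40 (block [Store 41 40]) (block []) ;; block [Add 39 39 5]) 8 (?I (Suc k)) r' m'"
  proof (rule wp_seq[where t = 4 and u = 4], rule wp_block)
    let ?r = "r'(40 := m' y + d, 41 := y + D, 42 := m' (y + D))"
    have "wp (cond 42 40 (block [Store 41 40]) (block []) ;; block [Add 39 39 5]) 4 (?I (Suc k)) ?r m'"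
    proof (rule wp_seq[where t = 3 and u = 1], rule wp_cond[where t = 1])
      assume lt: "?r 42 < ?r 40"
      show "wp (block [Store 41 40]) 1 (wp (block [Add 39 39 5]) 1 (?I (Suc k))) ?r m'"
      proof (rule wp_block)
        show "case fold exec [Store 41 40] (0, ?r, m') of (_, r', m') \<Rightarrow> wp (block [Add 39 39 5]) 1 (?I (Suc k)) r' m'"
          using fin[of ?r "m'(y + D := m' y + d)"] I regs upd lt by simp
      qed auto
    next
      assume "\<not> ?r 42 < ?r 40"
      then show "wp (block []) 1 (wp (block [Add 39 39 5]) 1 (?I (Suc k))) ?r m'"
        by (intro wp_block) (use fin[of ?r m'] I regs upd in auto)
    qed auto
    then show "case fold exec [Load 40 39, Add 40 40 35, Add 41 39 34, Load 42 41] (0, r', m') of (_, r', m') \<Rightarrow>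
        wp (cond 42 40 (block [Store 41 40]) (block []) ;; block [Add 39 39 5]) 4 (?I (Suc k)) r' m'"
      using regs by (simp add: add.commute)
  qed auto
  qed
qed

text \<open>The outer loop runs over \<open>h\<close>, the inner one over \<open>l\<close>. Register
  32 holds the extent \<open>2 ^ a * (n + 2)\<close> of a block and register 33 the distance
  \<open>2 ^ Suc b * (n + 2)\<close> to the next block. Register 0 is constantly zero, so adding it
  copies.\<close>

definition relax_blocks :: code where
  "relax_blocks = loop 36 37 (block [Add 38 36 32, Add 39 36 0] ;; relax_row ;; block [Add 36 36 33])"

lemma wp_relax_blocks:
  assumes r: "r 0 = 0" "r 5 = W" "r 36 = x" "r 37 = x + H * hi" "r 32 = N * W" "r 33 = hi"
      "r 34 = D" "r 35 = d"
    and pos: "0 < W" "0 < hi"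
    and A: "\<And>k. A k = {x + h * hi + i * W | h i. h < k \<and> i < N}"
    and apart: "\<And>y z. y \<in> A H \<Longrightarrow> z \<in> A H \<Longrightarrow> y \<noteq> z + D"
    and Q: "\<And>r'. (\<forall>i<36. r' i = r i) \<Longrightarrow> Q r' (relaxed m (A H) D d)"
    and t: "H * (N * 10 + 7) + 2 \<le> t"
  shows "wp relax_blocks t Q r m"
proof -
  let ?I = "\<lambda>k r' m'. (\<forall>i<36. r' i = r i) \<and> r' 36 = x + k * hi \<and> r' 37 = r 37 \<and> m' = relaxed m (A k) D d"
  show ?thesis
  unfolding relax_blocks_def
  proof (rule wp_loop[where I = ?I and N = "H"])
  have "A 0 = {}" by (auto simp: A)
  then show "?I 0 r m" using r by (simp add: relaxed_empty)
  show "Q r' m'" if "?I H r' m'" for r' m' using Q that by auto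
  show "r' 36 < r' 37 \<longleftrightarrow> k < H" if "k \<le> H" "?I k r' m'" for k r' m'
    using that r pos by auto
  show "H * (N * 10 + 5 + 2) + 2 \<le> t" using t by (simp add: add.commute)
  fix k r' m' assume k: "k < H" and I: "?I k r' m'"
  let ?B = "(\<lambda>i. x + k * hi + i * W) ` {..<N}"
  let ?r = "r'(38 := x + k * hi + N * W, 39 := x + k * hi)"
  have AS: "A (Suc k) = A k \<union> ?B"
    unfolding A by (auto simp: less_Suc_eq)
  have sub: "A k \<subseteq> A H" "?B \<subseteq> A H" using k unfolding A by fastforce+
  have upd: "relaxed m' ?B D d = relaxed m (A (Suc k)) D d"
  proof -
    have "y \<notin> (\<lambda>x. x + D) ` A k" if "y \<in> ?B" for y
      using that apart sub by blast
    from relaxed_relaxed[OF this] show ?thesis using I unfolding AS by simp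
  qed
  have "wp (relax_row ;; block [Add 36 36 33]) (N * 10 + 3) (?I (Suc k)) ?r m'"
  proof (rule wp_seq[where t = "N * 10 + 2" and u = 1], rule wp_relax_row)
    show "x + k * hi + i * W \<noteq> x + k * hi + j * W + D" if "i < N" "j < N" for i j
      using apart[of "x + k * hi + i * W" "x + k * hi + j * W"] sub that by auto
    fix r'' assume r'': "\<forall>i<39. r'' i = ?r i"
    show "wp (block [Add 36 36 33]) 1 (?I (Suc k)) r'' (relaxed m' ?B D d)"
      by (rule wp_block) (use I r r'' upd in auto)
  qed (use I r pos in auto)
  then show "wp (block [Add 38 36 32, Add 39 36 0] ;; relax_row ;; block [Add 36 36 33]) (N * 10 + 5)
      (?I (Suc k)) r' m'"
    by (intro wp_seq[where t = 2 and u = "N * 10 + 3"] wp_block) (use I r in auto)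
  qed
qed

text \<open>Row \<open>p + 1\<close> of the same mask is the next cell, hence shift 1 with gain
  0.\<close>

definition propagate :: code where
  "propagate = block [Const 34 1, Const 35 0, Add 39 26 27, Add 38 39 25] ;; relax_row ;; block [Add 27 27 1]"

text \<open>With \<open>lo = 2 ^ a * (n + 2)\<close> and \<open>hi = 2 ^ Suc b * (n + 2)\<close>,
  the difference \<open>hi - lo\<close> is the colour mask times the stride; adding the row distance
  \<open>e + 1 - p\<close> gives the shift. \<open>hi\<close> is a doubled table entry, so the
  powers need only reach \<open>2 ^ c\<close>.\<close>

definition process :: code where
  "process = block [Load 31 17, Add 31 31 9, Load 31 31, Add 31 31 1, Load 32 31, Add 31 31 1, Load 33 31,
       Add 32 32 21, Load 32 32, Add 33 33 21, Load 33 33, Add 33 33 33, Sub 34 33 32,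
       Add 36 17 1, Add 36 36 1, Load 35 36, Add 35 35 1, Sub 35 35 27, Add 34 34 35,
       Const 35 1, Add 36 26 27, Add 37 36 25] ;;
     relax_blocks ;; block [Add 17 17 2]"

text \<open>Register 28 receives the start of the next interval, or the sentinel
  \<open>n + 1\<close> when none is left, which makes every remaining position propagate.\<close>

definition sweep :: code where
  "sweep = loop 27 6
     (block [Add 28 6 0] ;;
      cond 17 18 (block [Add 28 17 1, Load 28 28]) (block []) ;;
      cond 27 28 propagate process)"

section \<open>Table addresses in base \<open>n + 2\<close>\<close>

lemma row_address_unique:
  fixes C C' W q q' :: nat
  assumes "C * W + q = C' * W + q'" "q < W" "q' < W"
  shows "C = C'" "q = q'"
proof -
  have "W \<noteq> 0" using assms by auto
  then have "C = (C * W + q) div W" using assms(2) by simp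
  also have "\<dots> = C'" unfolding assms(1) using assms(3) \<open>W \<noteq> 0\<close> by simp
  finally show "C = C'" .
  with assms(1) show "q = q'" by simp
qed

context interval_dp
begin

definition stored :: "nat \<Rightarrow> (nat \<Rightarrow> nat) \<Rightarrow> (nat \<Rightarrow> nat \<Rightarrow> nat) \<Rightarrow> bool" where
  "stored B m T \<longleftrightarrow> (\<forall>q\<le>Suc n. \<forall>C<2 ^ Suc c. m (B + C * (n + 2) + q) = T q C)"

text \<open>Relative to \<open>B\<close>, the row is the residue of the address modulo
  \<open>n + 2\<close>, and the shift changes it from \<open>p\<close> to \<open>q\<close>. This
  supplies the separation of sources and targets that the relaxation loops require.\<close>

lemma rows_apart:
  assumes "p < q" "q \<le> Suc n"
  shows "B + p + x * (n + 2) \<noteq> B + p + x' * (n + 2) + (M * (n + 2) + (q - p))"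
proof
  assume "B + p + x * (n + 2) = B + p + x' * (n + 2) + (M * (n + 2) + (q - p))"
  then have "x * (n + 2) + p = (x' + M) * (n + 2) + q"
    using assms(1) by (simp add: add_mult_distrib)
  from row_address_unique(2)[OF this] assms show False by simp
qed

text \<open>Translates address arithmetic into the recurrence: the shift \<open>D\<close> adds
  \<open>M\<close> to the mask and moves from row \<open>p\<close> to row \<open>q'\<close>.
  \<open>X\<close> is the set of source masks. Merging rows uses \<open>M = 0\<close>, adding an
  interval uses its colour mask.\<close>

lemma stored_relaxed:
  assumes st: "stored B m T" and pq: "p < q'" "q' \<le> Suc n" and D: "D = M * (n + 2) + (q' - p)"
    and q: "q \<le> Suc n" and C: "C < 2 ^ Suc c"
  shows "relaxed m ((\<lambda>x. B + p + x * (n + 2)) ` X) D d (B + C * (n + 2) + q) =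
    (if q = q' \<and> C \<in> (\<lambda>x. x + M) ` X then max (T q C) (T p (C - M) + d) else T q C)"
proof -
  let ?y = "B + C * (n + 2) + q"
  have addr: "B + p + x * (n + 2) + D = B + (x + M) * (n + 2) + q'" for x
    using pq by (simp add: D add_mult_distrib)
  have mem: "?y \<in> (\<lambda>x. x + D) ` (\<lambda>x. B + p + x * (n + 2)) ` X \<longleftrightarrow> q = q' \<and> C \<in> (\<lambda>x. x + M) ` X"
    unfolding image_image addr
  proof
    assume "?y \<in> (\<lambda>x. B + (x + M) * (n + 2) + q') ` X"
    then obtain x where x: "x \<in> X" "?y = B + (x + M) * (n + 2) + q'" by auto
    then have "C * (n + 2) + q = (x + M) * (n + 2) + q'" by simp
    from row_address_unique[OF this] x(1) q pq show "q = q' \<and> C \<in> (\<lambda>x. x + M) ` X" by auto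
  next
    assume "q = q' \<and> C \<in> (\<lambda>x. x + M) ` X"
    then show "?y \<in> (\<lambda>x. B + (x + M) * (n + 2) + q') ` X"
      by auto
  qed
  have val: "m (?y - D) = T p (C - M)" if hit: "q = q' \<and> C \<in> (\<lambda>x. x + M) ` X"
  proof -
    obtain x where x: "C = x + M" using hit by blast
    have "?y - D = B + x * (n + 2) + p" using addr[of x] x by (simp add: hit)
    then show ?thesis using st x C pq unfolding stored_def by simp
  qed
  have "m ?y = T q C" using st q C unfolding stored_def by simp
  then show ?thesis unfolding relaxed_def mem using val by auto
qed

lemma relaxed_below:
  assumes "y < B"
  shows "relaxed m ((\<lambda>x. B + p + x * w) ` X) D d y = m y"
  using assms by (auto simp: relaxed_def)

end

section \<open>The sweep on the machine, with its running time\<close>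

locale sweep_memory = interval_dp +
  fixes B PB XB QB :: nat and v ad :: "nat \<Rightarrow> nat" and r0 m0 :: "nat \<Rightarrow> nat"
  \<comment> \<open>\<open>PB\<close>: intervals by position; \<open>XB\<close>: vertex to address of its colour interval (\<open>ad\<close>); \<open>QB\<close>: powers of 2\<close>
  assumes regs: "r0 0 = 0" "r0 1 = 1" "r0 2 = 3" "r0 5 = n + 2" "r0 6 = n + 1" "r0 9 = XB"
      "r0 18 = PB + 3 * n" "r0 21 = QB" "r0 25 = 2 ^ Suc c * (n + 2)" "r0 26 = B"
    and below: "PB + 3 * n \<le> B" "\<And>i. i < n \<Longrightarrow> XB + v i < B" "\<And>i. i < n \<Longrightarrow> ad i + 2 < B" "QB + c < B"
    and mem: "\<And>i. i < n \<Longrightarrow> m0 (PB + 3 * i) = v i" "\<And>i. i < n \<Longrightarrow> m0 (PB + 3 * i + 1) = s i"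
      "\<And>i. i < n \<Longrightarrow> m0 (PB + 3 * i + 2) = e i"
      "\<And>i. i < n \<Longrightarrow> m0 (XB + v i) = ad i"
      "\<And>i. i < n \<Longrightarrow> m0 (ad i + 1) = a i" "\<And>i. i < n \<Longrightarrow> m0 (ad i + 2) = b i"
      "\<And>j. j \<le> c \<Longrightarrow> m0 (QB + j) = 2 ^ j * (n + 2)"
begin

text \<open>All lookup data lie below \<open>B\<close> and the table above, so table updates cannot
  damage the data. Of the registers below 28 only the interval pointer 17 and the position 27 change
  during the sweep.\<close>

definition state :: "nat \<Rightarrow> nat \<Rightarrow> (nat \<Rightarrow> nat \<Rightarrow> nat) \<Rightarrow> (nat \<Rightarrow> nat) \<Rightarrow> (nat \<Rightarrow> nat) \<Rightarrow> bool" where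
  "state p i T r m \<longleftrightarrow> (\<forall>j<27. j \<noteq> 17 \<longrightarrow> r j = r0 j) \<and> r 17 = PB + 3 * i \<and> r 27 = p \<and>
     (\<forall>y<B. m y = m0 y) \<and> stored B m T \<and> table p i T"

lemma state_regs:
  assumes "state p i T r m"
  shows "r 0 = 0" "r 1 = 1" "r 2 = 3" "r 5 = n + 2" "r 6 = n + 1" "r 9 = XB"
      "r 18 = PB + 3 * n" "r 21 = QB" "r 25 = 2 ^ Suc c * (n + 2)" "r 26 = B" "r 17 = PB + 3 * i" "r 27 = p"
  using assms regs by (auto simp: state_def)

lemma wp_propagate:
  assumes st: "state p i T r m" and p: "p \<le> n" "i < n \<Longrightarrow> p < s i"
    and Q: "\<And>T' r m. state (Suc p) i T' r m \<Longrightarrow> Q r m"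
  shows "wp propagate (27 * 2 ^ c) Q r m"
proof -
  note R = state_regs[OF st]
  let ?r = "r(34 := 1, 35 := 0, 39 := B + p, 38 := B + p + 2 ^ Suc c * (n + 2))"
  let ?m = "relaxed m ((\<lambda>x. B + p + x * (n + 2)) ` {..<2 ^ Suc c}) 1 0"
  have "wp (relax_row ;; block [Add 27 27 1]) (2 ^ Suc c * 10 + 3) Q ?r m"
  proof (rule wp_seq[where t = "2 ^ Suc c * 10 + 2" and u = 1], rule wp_relax_row)
    show "B + p + k * (n + 2) \<noteq> B + p + j * (n + 2) + 1" for k j
      using rows_apart[of p "Suc p" B k j 0] p by simp
    fix r' assume r': "\<forall>j<39. r' j = ?r j"
    let ?T = "\<lambda>q C. if q = Suc p then max (T q C) (T p C) else T q C"
    have "state (Suc p) i ?T (r'(27 := Suc p)) ?m"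
      unfolding state_def
    proof (intro conjI)
      show "\<forall>j<27. j \<noteq> 17 \<longrightarrow> (r'(27 := Suc p)) j = r0 j"
        using st r' by (simp add: state_def)
      show "\<forall>y<B. ?m y = m0 y"
        using st by (auto simp only: state_def relaxed_below)
      show "stored B ?m ?T"
        unfolding stored_def
      proof (intro allI impI)
        fix q C assume "q \<le> Suc n" "C < (2::nat) ^ Suc c"
        then show "?m (B + C * (n + 2) + q) = ?T q C"
          using st p by (subst stored_relaxed[where T = T and q' = "Suc p" and M = 0]) (auto simp: state_def)
      qed
      show "table (Suc p) i ?T"
        using st p by (intro table_propagate[where T = T]) (auto simp: state_def)
    qed (use R r' in auto)
    then have "Q (r'(27 := Suc p)) ?m" by (rule Q)
    moreover have "r' 27 = p" "r' 1 = 1" using R r' by auto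
    ultimately show "wp (block [Add 27 27 1]) 1 Q r' ?m"
      by (intro wp_block) simp_all
  qed (use R in auto)
  then have "wp propagate (4 + (2 ^ Suc c * 10 + 3)) Q r m"
    unfolding propagate_def
    by (intro wp_seq[where t = 4 and u = "2 ^ Suc c * 10 + 3"] wp_block)
       (use R in \<open>auto simp: ac_simps\<close>)
  then show ?thesis
  proof (rule wp_mono)
    have "(1::nat) \<le> 2 ^ c" by simp
    \<comment> \<open>27 is 20 for the \<open>2 * 2 ^ c\<close> masks at 10 steps each, plus 7
      constant steps.\<close>
    then show "4 + (2 ^ Suc c * 10 + 3) \<le> 27 * (2::nat) ^ c" unfolding power_Suc by linarith
  qed
qed

lemma wp_process:
  assumes st: "state p i T r m" and i: "i < n" "s i \<le> p"
    and Q: "\<And>T' r m. state p (Suc i) T' r m \<Longrightarrow> Q r m"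
  shows "wp process (42 * 2 ^ c) Q r m"
proof -
  note R = state_regs[OF st]
  have T: "table p i T" using st by (simp add: state_def)
  have sp: "s i = p" using T i unfolding table_def by (meson order_antisym order_refl)
  have pe: "p < Suc (e i)" "Suc (e i) \<le> Suc n" using pos[OF i(1)] sp by auto
  have ab: "a i \<le> b i" "b i \<le> c" using col[OF i(1)] by auto
  define M where "M = colour_mask (a i) (b i)"
  define D where "D = M * (n + 2) + (Suc (e i) - p)"
  define lo hi where "lo = 2 ^ a i * (n + 2)" and "hi = 2 ^ Suc (b i) * (n + 2)"
  \<comment> \<open>\<open>A k\<close> collects the source addresses of the first \<open>k\<close>
    blocks, \<open>X\<close> the masks avoiding the colours of \<open>i\<close>. Masks lie below
    \<open>2 ^ Suc c\<close>, so the quotient by \<open>2 ^ Suc (b i)\<close> lies below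
    \<open>2 ^ (c - b i)\<close>.\<close>
  define A where "A = (\<lambda>k::nat. {B + p + h * hi + j * (n + 2) | h j. h < k \<and> j < 2 ^ a i})"
  define X where "X = {h * 2 ^ Suc (b i) + l | h l. h < 2 ^ (c - b i) \<and> l < (2::nat) ^ a i}"
  have AX: "A (2 ^ (c - b i)) = (\<lambda>x. B + p + x * (n + 2)) ` X" (is "_ = ?f ` X")
  proof -
    have f: "?f (h * 2 ^ Suc (b i) + l) = B + p + h * hi + l * (n + 2)" for h l
      by (simp add: hi_def algebra_simps)
    show ?thesis
    proof (intro set_eqI iffI)
      fix y assume "y \<in> A (2 ^ (c - b i))"
      then obtain h j where "y = B + p + h * hi + j * (n + 2)" "h < 2 ^ (c - b i)" "j < 2 ^ a i"
        unfolding A_def by blast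
      then show "y \<in> ?f ` X" unfolding X_def f[symmetric] by blast
    next
      fix y assume "y \<in> ?f ` X"
      then obtain h l where "y = ?f (h * 2 ^ Suc (b i) + l)" "h < 2 ^ (c - b i)" "l < 2 ^ a i"
        unfolding X_def by blast
      then show "y \<in> A (2 ^ (c - b i))" unfolding A_def f by blast
    qed
  qed
  have XM: "C \<in> (\<lambda>x. x + M) ` X \<longleftrightarrow> (\<forall>j. a i \<le> j \<and> j \<le> b i \<longrightarrow> bit C j)"
    if C: "C < 2 ^ Suc c" for C
  proof
    assume "C \<in> (\<lambda>x. x + M) ` X"
    then obtain h l where "C = h * 2 ^ Suc (b i) + l + M" "l < 2 ^ a i"
      unfolding X_def by blast
    then show "\<forall>j. a i \<le> j \<and> j \<le> b i \<longrightarrow> bit C j"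
      using bit_block_mask[OF _ ab(1), of l h] by (simp add: M_def)
  next
    assume "\<forall>j. a i \<le> j \<and> j \<le> b i \<longrightarrow> bit C j"
    then obtain h l where hl: "l < 2 ^ a i" "C = h * 2 ^ Suc (b i) + l + M"
      using block_mask_exists[OF _ ab(1), of C] unfolding M_def by blast
    have "h * 2 ^ Suc (b i) < 2 ^ (c - b i) * 2 ^ Suc (b i)"
      using hl C ab by (simp flip: power_add del: power_Suc)
    then have "h < 2 ^ (c - b i)" by simp
    then have "h * 2 ^ Suc (b i) + l \<in> X" using hl unfolding X_def by blast
    then show "C \<in> (\<lambda>x. x + M) ` X" using hl(2) by blast
  qed
  let ?m = "relaxed m (?f ` X) D 1"
  let ?r = "r(31 := ad i + 2, 32 := lo, 33 := hi, 34 := D, 35 := 1, 36 := B + p,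
    37 := B + p + 2 ^ Suc c * (n + 2))"
  have "wp (relax_blocks ;; block [Add 17 17 2]) (2 ^ (c - b i) * (2 ^ a i * 10 + 7) + 3) Q ?r m"
  proof (rule wp_seq[where t = "2 ^ (c - b i) * (2 ^ a i * 10 + 7) + 2" and u = 1],
      rule wp_relax_blocks[where A = A and x = "B + p" and H = "2 ^ (c - b i)" and N = "2 ^ a i"
        and W = "n + 2" and hi = hi and D = D and d = 1])
    show "y \<noteq> z + D" if "y \<in> A (2 ^ (c - b i))" "z \<in> A (2 ^ (c - b i))" for y z
      using that unfolding AX D_def by (elim imageE) (simp only: rows_apart[OF pe] not_False_eq_True)
    show "A k = {B + p + h * hi + i' * (n + 2) | h i'. h < k \<and> i' < 2 ^ a i}" for k
      by (simp add: A_def)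
    have "2 ^ Suc c = (2::nat) ^ (c - b i) * 2 ^ Suc (b i)"
      using ab by (simp flip: power_add)
    then show "?r 37 = B + p + 2 ^ (c - b i) * hi" by (simp only: hi_def mult.assoc fun_upd_same)
    show "0 < hi" by (simp add: hi_def)
    fix r' assume r': "\<forall>j<36. r' j = ?r j"
    let ?T = "\<lambda>q C. if q = Suc (e i) \<and> (\<forall>j. a i \<le> j \<and> j \<le> b i \<longrightarrow> bit C j)
                then max (T q C) (Suc (T p (C - M))) else T q C"
    have "state p (Suc i) ?T (r'(17 := PB + 3 * Suc i)) ?m"
      unfolding state_def
    proof (intro conjI)
      show "\<forall>j<27. j \<noteq> 17 \<longrightarrow> (r'(17 := PB + 3 * Suc i)) j = r0 j"
        using st r' by (simp add: state_def)
      show "\<forall>y<B. ?m y = m0 y"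
        using st by (auto simp only: state_def relaxed_below)
      show "stored B ?m ?T"
        unfolding stored_def
      proof (intro allI impI)
        fix q C assume "q \<le> Suc n" "C < (2::nat) ^ Suc c"
        then show "?m (B + C * (n + 2) + q) = ?T q C"
          using st pe by (subst stored_relaxed[where T = T and q' = "Suc (e i)" and M = M])
            (auto simp: state_def D_def XM)
      qed
      show "table p (Suc i) ?T"
        using T i by (intro table_process[where T = T]) (auto simp: M_def)
    qed (use R r' in auto)
    then have "Q (r'(17 := PB + 3 * Suc i)) ?m" by (rule Q)
    moreover have "r' 17 = PB + 3 * i" "r' 2 = 3" using R r' by auto
    ultimately show "wp (block [Add 17 17 2]) 1 Q r' (relaxed m (A (2 ^ (c - b i))) D 1)"
      unfolding AX by (intro wp_block) (simp_all add: ac_simps)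
  qed (use R in \<open>auto simp: lo_def\<close>)
  moreover have "fold exec [Load 31 17, Add 31 31 9, Load 31 31, Add 31 31 1, Load 32 31, Add 31 31 1, Load 33 31,
       Add 32 32 21, Load 32 32, Add 33 33 21, Load 33 33, Add 33 33 33, Sub 34 33 32,
       Add 36 17 1, Add 36 36 1, Load 35 36, Add 35 35 1, Sub 35 35 27, Add 34 34 35,
       Const 35 1, Add 36 26 27, Add 37 36 25] (0, r, m) = (22, ?r, m)"
  proof -
    have low: "m y = m0 y" if "y < B" for y using st that by (simp add: state_def)
    have m1: "m (PB + 3 * i) = v i" "m (PB + 3 * i + 1 + 1) = e i"
      using low[of "PB + 3 * i"] low[of "PB + 3 * i + 2"] mem(1,3)[OF i(1)] below(1) i(1) by auto
    have m2: "m (v i + XB) = ad i" "m (ad i + 1) = a i" "m (ad i + 1 + 1) = b i"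
      using low[of "XB + v i"] low[of "ad i + 1"] low[of "ad i + 2"] mem(4,5,6)[OF i(1)]
        below(2,3)[OF i(1)] by (auto simp: ac_simps)
    have m3: "m (a i + QB) = lo" "m (b i + QB) + m (b i + QB) = hi"
      using low[of "QB + a i"] low[of "QB + b i"] mem(7)[of "a i"] mem(7)[of "b i"] ab below(4)
      by (auto simp: ac_simps lo_def hi_def)
    have "hi - lo = M * (n + 2)"
      unfolding hi_def lo_def M_def colour_mask_def by (simp only: diff_mult_distrib)
    then have D: "hi - lo + (e i + 1 - p) = D" by (simp add: D_def)
    show ?thesis
      by (simp add: R R(2)[simplified] m1[simplified] m2[simplified] m3 D[simplified] fun_eq_iff)
  qed
  ultimately have "wp process (22 + (2 ^ (c - b i) * (2 ^ a i * 10 + 7) + 3)) Q r m"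
    unfolding process_def
    by (intro wp_seq[where t = 22 and u = "2 ^ (c - b i) * (2 ^ a i * 10 + 7) + 3"] wp_block) auto
  then show ?thesis
  proof (rule wp_mono)
    \<comment> \<open>Here \<open>a i \<le> b i\<close> keeps the number of sources within
      \<open>2 ^ c\<close>. The factor 42 is 10 per source, 7 per block, and 3 + 22 constant
      steps.\<close>
    have "c - b i + a i \<le> c" using ab by simp
    then have "(2::nat) ^ (c - b i) * 2 ^ a i \<le> 2 ^ c" unfolding power_add[symmetric]
      by (rule power_increasing) simp
    moreover have "(2::nat) ^ (c - b i) \<le> 2 ^ c" by (rule power_increasing) auto
    moreover have "(1::nat) \<le> 2 ^ c" by simp
    ultimately show "22 + (2 ^ (c - b i) * (2 ^ a i * 10 + 7) + 3) \<le> 42 * (2::nat) ^ c"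
      unfolding add_mult_distrib2 mult.assoc[symmetric] by linarith
  qed
qed

lemma wp_sweep:
  assumes st: "state 1 0 T r m"
    and Q: "\<And>T' r m. state (Suc n) n T' r m \<Longrightarrow> Q r m"
    and t: "102 * 2 ^ c * n + 2 \<le> t"
  shows "wp sweep t Q r m"
proof -
  \<comment> \<open>Each round advances exactly one of \<open>p\<close> and \<open>i\<close>. The
    sum starts at \<open>1 + 0\<close> and ends at \<open>Suc n + n\<close>, hence
    \<open>2 * n\<close> rounds.\<close>
  let ?I = "\<lambda>k r m. \<exists>p i T. k + 1 = p + i \<and> state p i T r m"
  show ?thesis
  unfolding sweep_def
  proof (rule wp_loop[where I = ?I and N = "2 * n"])
  show "?I 0 r m" using st by force
  have p: "p \<le> Suc n" "i \<le> n" "p = Suc n \<Longrightarrow> i = n" if "state p i T r m" for p i T r m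
    using that table_final(1) by (auto simp: state_def table_def)
  show "Q r m" if I: "?I (2 * n) r m" for r m
  proof -
    obtain p i T where 1: "2 * n + 1 = p + i" "state p i T r m" using I by auto
    with p[OF 1(2)] have "p = Suc n" "i = n" by linarith+
    with 1(2) Q show ?thesis by blast
  qed
  show "r 27 < r 6 \<longleftrightarrow> k < 2 * n" if "k \<le> 2 * n" and I: "?I k r m" for k r m
  proof -
    obtain p' i' T where 1: "k + 1 = p' + i'" "state p' i' T r m" using I by auto
    have "p' < Suc n \<longleftrightarrow> k < 2 * n"
      using p[OF 1(2)] 1(1) that(1) by (cases "p' = Suc n") simp_all
    then show ?thesis using state_regs[OF 1(2)] by simp
  qed
  show "2 * n * (49 * 2 ^ c + 2) + 2 \<le> t"
  proof -
    have "(1::nat) \<le> 2 ^ c" by simp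
    then have "49 * 2 ^ c + 2 \<le> 51 * (2::nat) ^ c" by linarith
    then have "2 * n * (49 * 2 ^ c + 2) \<le> 2 * n * (51 * 2 ^ c)" by (rule mult_le_mono2)
    also have "\<dots> = 102 * 2 ^ c * n" by simp
    finally show ?thesis using t by linarith
  qed
  fix k r m assume k: "k < 2 * n" and "?I k r m"
  then obtain p' i T where 1: "k + 1 = p' + i" and st: "state p' i T r m" by auto
  note R = state_regs[OF st]
  have pn: "p' \<le> n" using p[OF st] 1 k by linarith
  define z where "z = (if i < n then s i else n + 1)"
  have body: "wp (cond 27 28 propagate process) (42 * 2 ^ c + 2) (?I (Suc k)) (r(28 := z)) m"
  proof (rule wp_cond)
    have st': "state p' i T (r(28 := z)) m" using st by (auto simp: state_def)
    {
      assume "(r(28 := z)) 27 < (r(28 := z)) 28"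
      then have "i < n \<Longrightarrow> p' < s i" using R by (simp add: z_def)
      then have "wp propagate (27 * 2 ^ c) (?I (Suc k)) (r(28 := z)) m"
        using 1 by (intro wp_propagate[OF st' pn]) force+
      then show "wp propagate (42 * 2 ^ c) (?I (Suc k)) (r(28 := z)) m"
        by (rule wp_mono) auto
    next
      assume "\<not> (r(28 := z)) 27 < (r(28 := z)) 28"
      then have "i < n" "s i \<le> p'" using R pn by (auto simp: z_def split: if_splits)
      then show "wp process (42 * 2 ^ c) (?I (Suc k)) (r(28 := z)) m"
        using 1 by (intro wp_process[OF st']) force+
    }
  qed simp
  have ms: "m (PB + 3 * i + 1) = s i" if "i < n"
    using st below(1) that mem(2)[OF that] by (simp add: state_def)
  have load: "wp (cond 17 18 (block [Add 28 17 1, Load 28 28]) (block []) ;; cond 27 28 propagate process)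
      (42 * 2 ^ c + 6) (?I (Suc k)) (r(28 := n + 1)) m"
  proof (rule wp_seq[where t = 4 and u = "42 * 2 ^ c + 2"], rule wp_cond[where t = 2])
    assume "(r(28 := n + 1)) 17 < (r(28 := n + 1)) 18"
    then have "i < n" using R by simp
    then show "wp (block [Add 28 17 1, Load 28 28]) 2 (wp (cond 27 28 propagate process) (42 * 2 ^ c + 2) (?I (Suc k)))
        (r(28 := n + 1)) m"
      by (intro wp_block) (use body R ms in \<open>simp_all add: z_def\<close>)
  next
    assume "\<not> (r(28 := n + 1)) 17 < (r(28 := n + 1)) 18"
    then have "\<not> i < n" using R by simp
    then show "wp (block []) 2 (wp (cond 27 28 propagate process) (42 * 2 ^ c + 2) (?I (Suc k)))
        (r(28 := n + 1)) m"
      by (intro wp_block) (use body in \<open>simp_all add: z_def\<close>)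
  qed simp_all
  have "(1::nat) \<le> 2 ^ c" by simp
  then have "1 + (42 * 2 ^ c + 6) \<le> 49 * (2::nat) ^ c" by linarith
  then show "wp (block [Add 28 6 0] ;; cond 17 18 (block [Add 28 17 1, Load 28 28]) (block []) ;;
      cond 27 28 propagate process) (49 * 2 ^ c) (?I (Suc k)) r m"
    by (intro wp_seq[where t = 1 and u = "42 * 2 ^ c + 6"] wp_block) (use load R in simp_all)
  qed
qed

end

section \<open>Compact representations\<close>

text \<open>Removes the real numbers: two nonempty closed intervals meet iff each starts no later
  than the other ends.\<close>

lemma compact_representation_iff:
  "compact_representation c V E R \<longleftrightarrow>
     distinct (map fst R) \<and> fst ` set R = V \<and>
     (\<forall>(v, a, b)\<in>set R. 1 \<le> a \<and> a \<le> b \<and> b \<le> c) \<and> sorted (map (\<lambda>(v, a, b). a) R) \<and>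
     E = {{u, v} | u v a b x y. (u, a, b) \<in> set R \<and> (v, x, y) \<in> set R \<and> u \<noteq> v \<and> a \<le> y \<and> x \<le> b}"
proof -
  let ?f = "\<lambda>(v, a, b). (v, real a, real b)"
  have fst: "map fst (map ?f R) = map fst R" by (auto simp: comp_def split: prod.splits)
  have in_map: "(v, x, y) \<in> set (map ?f R) \<longleftrightarrow> (\<exists>a b. (v, a, b) \<in> set R \<and> x = real a \<and> y = real b)" for v x y
    by force
  have edges: "{{u, v} | u v a b c d. (u, a, b) \<in> set (map ?f R) \<and> (v, c, d) \<in> set (map ?f R) \<and> u \<noteq> v \<and>
      {a..b} \<inter> {c..d} \<noteq> {}} =
    {{u, v} | u v a b x y. (u, a, b) \<in> set R \<and> (v, x, y) \<in> set R \<and> u \<noteq> v \<and> a \<le> y \<and> x \<le> b}"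
    if "\<forall>(v, a, b)\<in>set R. a \<le> b"
  proof -
    have meet: "{real a..real b} \<inter> {real x..real y} \<noteq> {} \<longleftrightarrow> a \<le> y \<and> x \<le> b"
      if "(u, a, b) \<in> set R" "(v, x, y) \<in> set R" for u v a b x y
    proof -
      have "a \<le> b" "x \<le> y" using that \<open>\<forall>(v, a, b)\<in>set R. a \<le> b\<close> by auto
      then show ?thesis by (simp add: Int_atLeastAtMost) linarith
    qed
    show ?thesis
      unfolding in_map
    proof (intro Collect_cong iffI; elim exE conjE)
      fix X u v a b x y a' b' x' y'
      assume "X = {u, v}" "u \<noteq> v" "{a..b} \<inter> {x..y} \<noteq> {}" "(u, a', b') \<in> set R" "a = real a'" "b = real b'"
        "(v, x', y') \<in> set R" "x = real x'" "y = real y'"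
      with meet[of u a' b' v x' y']
      have "X = {u, v} \<and> (u, a', b') \<in> set R \<and> (v, x', y') \<in> set R \<and> u \<noteq> v \<and> a' \<le> y' \<and> x' \<le> b'" by simp
      then show "\<exists>u v a b x y. X = {u, v} \<and> (u, a, b) \<in> set R \<and> (v, x, y) \<in> set R \<and> u \<noteq> v \<and> a \<le> y \<and> x \<le> b"
        by blast
    next
      fix X u v a b x y
      assume "X = {u, v}" "(u, a, b) \<in> set R" "(v, x, y) \<in> set R" "u \<noteq> v" "a \<le> y" "x \<le> b"
      with meet[of u a b v x y]
      show "\<exists>u v a b c d. X = {u, v} \<and> (\<exists>a' b'. (u, a', b') \<in> set R \<and> a = real a' \<and> b = real b') \<and>
          (\<exists>a b. (v, a, b) \<in> set R \<and> c = real a \<and> d = real b) \<and> u \<noteq> v \<and> {a..b} \<inter> {c..d} \<noteq> {}"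
        by (intro exI[of _ u] exI[of _ v] exI[of _ "real a"] exI[of _ "real b"] exI[of _ "real x"]
            exI[of _ "real y"]) blast
    qed
  qed
  have vertices: "fst ` set (map ?f R) = fst ` set R" by force
  have ordered: "(\<forall>(v, a, b)\<in>set (map ?f R). a \<le> b) \<longleftrightarrow> (\<forall>(v, a, b)\<in>set R. a \<le> b)" by force
  have bounds: "(\<forall>(v, a, b)\<in>set R. 1 \<le> a \<and> a \<le> b \<and> b \<le> c) \<longleftrightarrow>
      (\<forall>(v, a, b)\<in>set R. a \<le> b) \<and> (\<forall>(v, a, b)\<in>set R. a \<in> {1..c} \<and> b \<in> {1..c})"
    by fastforce
  show ?thesis
    unfolding compact_representation_def interval_representation_def fst vertices ordered bounds
    by (rule iffI; elim conjE; intro conjI; (assumption | simp only: edges))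
qed

lemma compactness_minimal: "compact c V E \<Longrightarrow> compactness V E \<le> c"
  unfolding compactness_def by (rule Least_le)

text \<open>Replacing every coordinate by the number of start points up to it preserves all intersections.\<close>

lemma compactness_le_length:
  assumes "compact_representation c V E R"
  shows "compactness V E \<le> length R"
proof -
  define A where "A = (\<lambda>(v, a, b). a) ` set R"
  define rk where "rk x = card {y \<in> A. y \<le> x}" for x
  let ?f = "\<lambda>(v, a, b). (v, rk a, rk b)"
  have fin: "finite {y \<in> A. y \<le> x}" for x by (simp add: A_def)
  have mono: "rk x \<le> rk y" if "x \<le> y" for x y
    unfolding rk_def by (rule card_mono[OF fin]) (use that in auto)
  have strict: "rk x < rk y" if "x < y" "y \<in> A" for x y
    unfolding rk_def by (rule psubset_card_mono[OF fin]) (use that in force)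
  \<comment> \<open>A start point is counted in its own rank but not in the rank of anything
    smaller, so order is reflected when the left argument is a start point. Both comparisons
    deciding an edge have this form.\<close>
  have le_iff: "rk x \<le> rk y \<longleftrightarrow> x \<le> y" if "x \<in> A" for x y
    using mono strict that by (meson linorder_not_le)
  have start: "a \<in> A" if "(v, a, b) \<in> set R" for v a b
    using that by (force simp: A_def)
  have pos: "1 \<le> rk a" if "a \<in> A" for a
    unfolding rk_def using that fin[of a] by (auto simp: Suc_le_eq card_gt_0_iff)
  have "rk x \<le> card A" for x unfolding rk_def by (rule card_mono) (auto simp: A_def)
  also have "card A \<le> length R"
    unfolding A_def by (meson card_image_le card_length le_trans finite_set)
  finally have bound: "rk x \<le> length R" for x .
  note R = assms[unfolded compact_representation_iff]
  have le: "\<forall>(v, a, b)\<in>set R. a \<le> b" using R by fast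
  have in_map: "(v, x, y) \<in> set (map ?f R) \<longleftrightarrow> (\<exists>a b. (v, a, b) \<in> set R \<and> x = rk a \<and> y = rk b)" for v x y
    by force
  have "compact_representation (length R) V E (map ?f R)"
    unfolding compact_representation_iff
  proof (intro conjI)
    have "map fst (map ?f R) = map fst R" by (auto simp: comp_def split: prod.splits)
    then show "distinct (map fst (map ?f R))" using R by metis
    have "fst ` set (map ?f R) = fst ` set R" by force
    then show "fst ` set (map ?f R) = V" using R by (elim conjE) simp
    show "\<forall>(v, a, b)\<in>set (map ?f R). 1 \<le> a \<and> a \<le> b \<and> b \<le> length R"
    proof clarify
      fix v x y assume "(v, x, y) \<in> set (map ?f R)"
      then obtain a b where ab: "(v, a, b) \<in> set R" "x = rk a" "y = rk b" using in_map by blast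
      moreover have "a \<le> b" using le ab(1) by blast
      ultimately show "1 \<le> x \<and> x \<le> y \<and> y \<le> length R" using pos start mono bound by blast
    qed
    have "sorted (map rk (map (\<lambda>(v, a, b). a) R))"
      using R by (intro sorted_map_mono) (auto simp: mono_on_def mono)
    moreover have "map rk (map (\<lambda>(v, a, b). a) R) = map (\<lambda>(v, a, b). a) (map ?f R)"
      by auto
    ultimately show "sorted (map (\<lambda>(v, a, b). a) (map ?f R))" by (simp only:)
    have "E = {{u, v} | u v a b x y. (u, a, b) \<in> set R \<and> (v, x, y) \<in> set R \<and> u \<noteq> v \<and> a \<le> y \<and> x \<le> b}"
      using R by blast
    also have "\<dots> = {{u, v} | u v a b x y. (u, a, b) \<in> set (map ?f R) \<and> (v, x, y) \<in> set (map ?f R) \<and> u \<noteq> v \<and> a \<le> y \<and> x \<le> b}"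
      unfolding in_map
    proof (intro Collect_cong iffI; elim exE conjE)
      fix X u v a b x y
      assume "X = {u, v}" "(u, a, b) \<in> set R" "(v, x, y) \<in> set R" "u \<noteq> v" "a \<le> y" "x \<le> b"
      then show "\<exists>u v a b x y. X = {u, v} \<and> (\<exists>a' b'. (u, a', b') \<in> set R \<and> a = rk a' \<and> b = rk b') \<and>
          (\<exists>a b. (v, a, b) \<in> set R \<and> x = rk a \<and> y = rk b) \<and> u \<noteq> v \<and> a \<le> y \<and> x \<le> b"
        using mono by blast
    next
      fix X u v a b x y a' b' x' y'
      assume "X = {u, v}" "u \<noteq> v" "a \<le> y" "x \<le> b" "(u, a', b') \<in> set R" "a = rk a'" "b = rk b'"
        "(v, x', y') \<in> set R" "x = rk x'" "y = rk y'"
      then show "\<exists>u v a b x y. X = {u, v} \<and> (u, a, b) \<in> set R \<and> (v, x, y) \<in> set R \<and> u \<noteq> v \<and> a \<le> y \<and> x \<le> b"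
        using le_iff start by blast
    qed
    finally show "E = {{u, v} | u v a b x y. (u, a, b) \<in> set (map ?f R) \<and> (v, x, y) \<in> set (map ?f R) \<and>
        u \<noteq> v \<and> a \<le> y \<and> x \<le> b}" .
  qed
  then have "compact (length R) V E" unfolding compact_def by blast
  then show ?thesis by (rule compactness_minimal)
qed

text \<open>The encoded input does not state the compactness, so the program reads off the largest
  end point instead. The inserted 0 gives \<open>Max\<close> a value on the empty list.\<close>

definition max_end :: "('v \<times> nat \<times> nat) list \<Rightarrow> nat" where
  "max_end R = Max (insert 0 ((snd \<circ> snd) ` set R))"

lemma max_end_le_compactness:
  assumes "compact_representation c V E R"
  shows "max_end R \<le> c"
  using assms unfolding compact_representation_iff max_end_def by fastforce

lemma max_end_ge: "(v, a, b) \<in> set R \<Longrightarrow> b \<le> max_end R"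
  unfolding max_end_def by (intro Max_ge) force+

text \<open>One of the two graphs attains \<open>c_exists\<close>; its compactness, and with it the
  largest end point of its list, is at most that number.\<close>

lemma min_max_end_le_c_exists:
  assumes "compact_representation (compactness V E1) V E1 R1"
    "compact_representation (compactness V E2) V E2 R2"
  shows "min (max_end R1) (max_end R2) \<le> c_exists V E1 E2"
proof -
  have "compact (compactness V E1) V E1 \<or> compact (compactness V E1) V E2"
    using assms by (auto simp: compact_def)
  then have "compact (c_exists V E1 E2) V E1 \<or> compact (c_exists V E1 E2) V E2"
    unfolding c_exists_def by (rule LeastI[where P = "\<lambda>c. compact c V E1 \<or> compact c V E2"])
  then have "compactness V E1 \<le> c_exists V E1 E2 \<or> compactness V E2 \<le> c_exists V E1 E2"
    using compactness_minimal by blast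
  then show ?thesis using assms[THEN max_end_le_compactness] by auto
qed

lemma compact_representation_length:
  assumes "compact_representation c {..<n} E R"
  shows "length R = n"
proof -
  have "distinct (map fst R)" "set (map fst R) = {..<n}"
    using assms by (auto simp: compact_representation_iff)
  from distinct_card[OF this(1)] this(2) show ?thesis by simp
qed

lemma compact_representation_inj:
  assumes "compact_representation c {..<n} E R"
  shows "inj_on (\<lambda>i. fst (R ! i)) {..<n}" "(\<lambda>i. fst (R ! i)) ` {..<n} = {..<n}"
proof -
  note D = assms[unfolded compact_representation_iff]
  show "inj_on (\<lambda>i. fst (R ! i)) {..<n}"
    using D compact_representation_length[OF assms] by (auto simp: distinct_conv_nth inj_on_def)
  have "fst ` set R = (\<lambda>i. fst (R ! i)) ` {..<n}"
    unfolding set_conv_nth compact_representation_length[OF assms] by auto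
  then show "(\<lambda>i. fst (R ! i)) ` {..<n} = {..<n}" using D by simp
qed

text \<open>Each vertex has a unique interval in the list, so any pair witnessing the edge consists
  of the given entries, in one order or the other, and the condition is symmetric.\<close>

lemma compact_representation_edge:
  assumes R: "compact_representation c {..<n} E R" and ij: "i < n" "j < n" "i \<noteq> j"
  shows "{fst (R ! i), fst (R ! j)} \<in> E \<longleftrightarrow>
    fst (snd (R ! i)) \<le> snd (snd (R ! j)) \<and> fst (snd (R ! j)) \<le> snd (snd (R ! i))"
proof -
  note len = compact_representation_length[OF R]
  note D = R[unfolded compact_representation_iff]
  obtain u a b where Ri: "R ! i = (u, a, b)" by (cases "R ! i")
  obtain v x y where Rj: "R ! j = (v, x, y)" by (cases "R ! j")
  have mem: "(u, a, b) \<in> set R" "(v, x, y) \<in> set R"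
    using ij len Ri Rj nth_mem by metis+
  have uv: "u \<noteq> v"
    using compact_representation_inj(1)[OF R] ij Ri Rj by (auto simp: inj_on_def)
  have uniq: "p = q" if "(w, p) \<in> set R" "(w, q) \<in> set R" for w p q
    using D that by (meson eq_key_imp_eq_value)
  have "{u, v} \<in> E \<longleftrightarrow> a \<le> y \<and> x \<le> b"
  proof
    assume "{u, v} \<in> E"
    then obtain u' v' a' b' x' y' where "{u, v} = {u', v'}" and
      *: "(u', a', b') \<in> set R" "(v', x', y') \<in> set R" "a' \<le> y'" "x' \<le> b'"
      using D by blast
    then consider "u' = u" "v' = v" | "u' = v" "v' = u" by (auto simp: doubleton_eq_iff)
    then show "a \<le> y \<and> x \<le> b"
      by cases (use * mem uniq in blast)+
  next
    assume "a \<le> y \<and> x \<le> b"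
    then show "{u, v} \<in> E" using D mem uv by blast
  qed
  then show ?thesis by (simp add: Ri Rj)
qed

lemma compact_representation_nth:
  assumes "compact_representation c {..<n} E R" "i < n"
  shows "fst (R ! i) < n" "1 \<le> fst (snd (R ! i))" "fst (snd (R ! i)) \<le> snd (snd (R ! i))"
    "snd (snd (R ! i)) \<le> max_end R" "snd (snd (R ! i)) \<le> c"
proof -
  have D: "fst ` set R = {..<n}" "\<forall>(v, a, b)\<in>set R. 1 \<le> a \<and> a \<le> b \<and> b \<le> c"
    using assms(1) unfolding compact_representation_iff by blast+
  obtain v a b where Ri: "R ! i = (v, a, b)" by (cases "R ! i")
  have mem: "(v, a, b) \<in> set R"
    using assms(2) compact_representation_length[OF assms(1)] Ri by (metis nth_mem)
  have "v < n" using D(1) mem by force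
  moreover have "1 \<le> a \<and> a \<le> b \<and> b \<le> c" using D(2) mem by blast
  ultimately show "fst (R ! i) < n" "1 \<le> fst (snd (R ! i))" "fst (snd (R ! i)) \<le> snd (snd (R ! i))"
    "snd (snd (R ! i)) \<le> max_end R" "snd (snd (R ! i)) \<le> c"
    using max_end_ge[OF mem] by (simp_all add: Ri)
qed

lemma compact_representation_sorted:
  assumes "compact_representation c {..<n} E R" "i \<le> j" "j < n"
  shows "fst (snd (R ! i)) \<le> fst (snd (R ! j))"
proof -
  have "sorted (map (\<lambda>(v, a, b). a) R)" "length R = n"
    using assms compact_representation_length by (auto simp: compact_representation_iff)
  from sorted_nth_mono[OF this(1), of i j] this(2) assms(2,3) show ?thesis
    by (simp add: case_prod_unfold)
qed

section \<open>Independent sets of the union graph as packings\<close>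

locale representation_pair =
  fixes n cA cB :: nat and EA EB :: "nat set set" and RA RB :: "(nat \<times> nat \<times> nat) list"
  assumes RA: "compact_representation cA {..<n} EA RA"
    and RB: "compact_representation cB {..<n} EB RB"
    and cB: "cB \<le> n"
begin

text \<open>The two lists may order the vertices differently. \<open>RB\<close> supplies positions
  and fixes the processing order; \<open>RA\<close> supplies colours and is accessed through this
  index translation.\<close>

definition partner :: "nat \<Rightarrow> nat" where
  "partner i = (SOME j. j < n \<and> fst (RA ! j) = fst (RB ! i))"

lemma partner:
  assumes "i < n"
  shows "partner i < n" "fst (RA ! partner i) = fst (RB ! i)"
proof -
  have "fst (RB ! i) \<in> (\<lambda>i. fst (RA ! i)) ` {..<n}"
    using compact_representation_inj(2)[OF RA] compact_representation_nth(1)[OF RB assms] by simp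
  then have "\<exists>j. j < n \<and> fst (RA ! j) = fst (RB ! i)" by force
  then have "partner i < n \<and> fst (RA ! partner i) = fst (RB ! i)"
    unfolding partner_def by (rule someI_ex)
  then show "partner i < n" "fst (RA ! partner i) = fst (RB ! i)" by auto
qed

sublocale interval_dp n "max_end RA" "\<lambda>i. fst (snd (RB ! i))" "\<lambda>i. snd (snd (RB ! i))"
  "\<lambda>i. fst (snd (RA ! partner i))" "\<lambda>i. snd (snd (RA ! partner i))"
proof
  fix i assume i: "i < n"
  show "1 \<le> fst (snd (RB ! i)) \<and> fst (snd (RB ! i)) \<le> snd (snd (RB ! i)) \<and> snd (snd (RB ! i)) \<le> n"
    using compact_representation_nth[OF RB i] cB by auto
  show "1 \<le> fst (snd (RA ! partner i)) \<and> fst (snd (RA ! partner i)) \<le> snd (snd (RA ! partner i)) \<and>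
      snd (snd (RA ! partner i)) \<le> max_end RA"
    using compact_representation_nth[OF RA partner(1)[OF i]] by auto
next
  show "fst (snd (RB ! i)) \<le> fst (snd (RB ! j))" if "i \<le> j" "j < n" for i j
    using compact_representation_sorted[OF RB that] .
qed

text \<open>The full mask admits every colour, so only pairwise disjointness in both representations
  remains, which is nonadjacency in both graphs.\<close>

lemma packing_iff_independent:
  assumes "S \<subseteq> {..<n}"
  shows "packing n (2 ^ Suc (max_end RA) - 1) S \<longleftrightarrow>
    independent_set {..<n} (EA \<union> EB) ((\<lambda>i. fst (RB ! i)) ` S)"
proof -
  let ?f = "\<lambda>i. fst (RB ! i)"
  have bits: "\<forall>x\<in>S. \<forall>j. fst (snd (RA ! partner x)) \<le> j \<and> j \<le> snd (snd (RA ! partner x)) \<longrightarrow>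
      bit (2 ^ Suc (max_end RA) - 1 :: nat) j"
  proof (intro ballI allI impI)
    fix x j assume "x \<in> S" "fst (snd (RA ! partner x)) \<le> j \<and> j \<le> snd (snd (RA ! partner x))"
    then have "j < Suc (max_end RA)" using col[of x] assms by force
    then show "bit (2 ^ Suc (max_end RA) - 1 :: nat) j"
      unfolding mask_eq_exp_minus_1[symmetric] bit_mask_iff by simp
  qed
  have inj: "?f x = ?f y \<longleftrightarrow> x = y" if "x < n" "y < n" for x y
    using compact_representation_inj(1)[OF RB] that by (auto simp: inj_on_def)
  \<comment> \<open>\<open>independent_set\<close> also tests pairs with \<open>u = v\<close>,
    whereas \<open>packing\<close> compares distinct indices; the absence of loops reconciles
    them.\<close>
  have single: "{u} \<notin> EA \<union> EB" for u
    using RA RB unfolding compact_representation_iff by auto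
  have edge: "{?f x, ?f y} \<notin> EA \<union> EB \<longleftrightarrow>
      (snd (snd (RB ! x)) < fst (snd (RB ! y)) \<or> snd (snd (RB ! y)) < fst (snd (RB ! x))) \<and>
      (snd (snd (RA ! partner x)) < fst (snd (RA ! partner y)) \<or>
       snd (snd (RA ! partner y)) < fst (snd (RA ! partner x)))"
    if "x < n" "y < n" "x \<noteq> y" for x y
  proof -
    have "partner x \<noteq> partner y" using partner(2) that inj by metis
    from compact_representation_edge[OF RA partner(1)[OF that(1)] partner(1)[OF that(2)] this]
      compact_representation_edge[OF RB that] partner(2)[OF that(1)] partner(2)[OF that(2)]
    show ?thesis by auto
  qed
  have "packing n (2 ^ Suc (max_end RA) - 1) S \<longleftrightarrow> (\<forall>x\<in>S. \<forall>y\<in>S. x \<noteq> y \<longrightarrow> {?f x, ?f y} \<notin> EA \<union> EB)"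
  proof -
    have "(\<forall>x\<in>S. \<forall>y\<in>S. x \<noteq> y \<longrightarrow> {?f x, ?f y} \<notin> EA \<union> EB) \<longleftrightarrow>
      (\<forall>x\<in>S. \<forall>y\<in>S. x \<noteq> y \<longrightarrow>
        (snd (snd (RB ! x)) < fst (snd (RB ! y)) \<or> snd (snd (RB ! y)) < fst (snd (RB ! x))) \<and>
        (snd (snd (RA ! partner x)) < fst (snd (RA ! partner y)) \<or>
         snd (snd (RA ! partner y)) < fst (snd (RA ! partner x))))"
      by (intro ball_cong refl imp_cong edge) (use assms in auto)
    then show ?thesis unfolding packing_def using assms bits by blast
  qed
  also have "\<dots> \<longleftrightarrow> independent_set {..<n} (EA \<union> EB) (?f ` S)"
  proof -
    have "?f ` S \<subseteq> {..<n}" using compact_representation_inj(2)[OF RB] assms by blast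
    moreover have "{?f x, ?f x} \<notin> EA \<union> EB" for x using single by simp
    ultimately show ?thesis unfolding independent_set_def ball_simps by metis
  qed
  finally show ?thesis .
qed

text \<open>The problem asks for size exactly \<open>k\<close>, the table holds a maximum; both
  agree because subsets of independent sets are independent.\<close>

lemma two_union_iff_table:
  assumes "table (Suc n) n T"
  shows "two_union_independent_set {..<n} EA EB k \<longleftrightarrow> k \<le> T (Suc n) (2 ^ Suc (max_end RA) - 1)"
proof
  let ?f = "\<lambda>i. fst (RB ! i)"
  let ?C = "2 ^ Suc (max_end RA) - 1 :: nat"
  note f = compact_representation_inj[OF RB]
  {
    assume "two_union_independent_set {..<n} EA EB k"
    then obtain U where U: "independent_set {..<n} (EA \<union> EB) U" "card U = k"
      by (auto simp: two_union_independent_set_def)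
    then obtain S where S: "S \<subseteq> {..<n}" "U = ?f ` S"
      using f(2) by (metis (no_types, lifting) independent_set_def subset_imageE)
    then have "packing n ?C S" using packing_iff_independent U by blast
    moreover have "card S = k" using U S f(1) by (metis card_image inj_on_subset)
    ultimately show "k \<le> T (Suc n) ?C" using table_final(3)[OF assms] by blast
  next
    assume k: "k \<le> T (Suc n) ?C"
    obtain S where S: "packing n ?C S" "card S = T (Suc n) ?C" using table_final(2)[OF assms] by blast
    have sub: "S \<subseteq> {..<n}" using S by (simp add: packing_def)
    obtain S' where S': "S' \<subseteq> S" "card S' = k"
      using k S(2) by (metis obtain_subset_with_card_n)
    have "independent_set {..<n} (EA \<union> EB) (?f ` S)" using packing_iff_independent[OF sub] S by blast
    then have "independent_set {..<n} (EA \<union> EB) (?f ` S')"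
      using S'(1) unfolding independent_set_def by blast
    moreover have "card (?f ` S') = k"
      using S' sub f(1) by (metis card_image inj_on_subset)
    ultimately show "two_union_independent_set {..<n} EA EB k"
      unfolding two_union_independent_set_def by blast
  }
qed

end

section \<open>The complete program\<close>

definition represents :: "(nat \<Rightarrow> nat) \<Rightarrow> nat \<Rightarrow> (nat \<times> nat \<times> nat) list \<Rightarrow> bool" where
  "represents m p R \<longleftrightarrow> (\<forall>i<length R. m (p + 3 * i) = fst (R ! i) \<and>
     m (p + 3 * i + 1) = fst (snd (R ! i)) \<and> m (p + 3 * i + 2) = snd (snd (R ! i)))"

lemma represents_cong:
  assumes "represents m p R" "\<And>y. y < p + 3 * length R \<Longrightarrow> m' y = m y"
  shows "represents m' p R"
  using assms by (simp add: represents_def)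

lemma length_encode_representation [simp]: "length (encode_representation R) = 3 * length R"
  by (induction R) (auto simp: encode_representation_def)

lemma nth_encode_representation:
  assumes "i < length R"
  shows "encode_representation R ! (3 * i) = fst (R ! i)"
    "encode_representation R ! (3 * i + 1) = fst (snd (R ! i))"
    "encode_representation R ! (3 * i + 2) = snd (snd (R ! i))"
proof -
  have cons: "encode_representation ((v, a, b) # R) = v # a # b # encode_representation R" for v a b R
    by (simp add: encode_representation_def)
  have "encode_representation R ! (3 * i) = fst (R ! i) \<and>
    encode_representation R ! (3 * i + 1) = fst (snd (R ! i)) \<and>
    encode_representation R ! (3 * i + 2) = snd (snd (R ! i))"
    using assms
  proof (induction R arbitrary: i)
    case Nil
    then show ?case by simp
  next
    case (Cons x R)
    obtain v a b where x: "x = (v, a, b)" by (cases x)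
    show ?case
    proof (cases i)
      case 0
      then show ?thesis by (simp add: x cons)
    next
      case (Suc j)
      then show ?thesis using Cons by (simp add: x cons)
    qed
  qed
  then show "encode_representation R ! (3 * i) = fst (R ! i)"
    "encode_representation R ! (3 * i + 1) = fst (snd (R ! i))"
    "encode_representation R ! (3 * i + 2) = snd (snd (R ! i))" by auto
qed

definition max_end_code :: "nat \<Rightarrow> nat \<Rightarrow> code" where
  "max_end_code stop dst = loop 10 stop
     (block [Add 12 10 1, Add 12 12 1, Load 13 12] ;;
      cond dst 13 (block [Add dst 13 0]) (block []) ;; block [Add 10 10 2])"

text \<open>The scan leaves register 10 at the end of the list. After the first list this is the
  start of the second, so the second scan can follow directly.\<close>

lemma wp_max_end:
  assumes regs: "stop \<in> {8, 9}" "dst \<in> {11, 14}"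
    and r: "r 0 = 0" "r 1 = 1" "r 2 = 3" "r 10 = p" "r stop = p + 3 * length R" "r dst = 0"
    and m: "represents m p R"
    and Q: "\<And>r'. (\<forall>i. i \<notin> {10, 12, 13, dst} \<longrightarrow> r' i = r i) \<Longrightarrow> r' 10 = r stop \<Longrightarrow>
      r' dst = max_end R \<Longrightarrow> Q r' m"
    and t: "length R * 9 + 2 \<le> t"
  shows "wp (max_end_code stop dst) t Q r m"
proof -
  define M where "M k = Max (insert 0 ((snd \<circ> snd) ` set (take k R)))" for k
  let ?I = "\<lambda>k r' m'. (\<forall>i. i \<notin> {10, 12, 13, dst} \<longrightarrow> r' i = r i) \<and> r' 10 = p + 3 * k \<and>
    r' dst = M k \<and> m' = m"
  show ?thesis
    unfolding max_end_code_def
  proof (rule wp_loop[where I = ?I and N = "length R"])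
    show "?I 0 r m" using r by (simp add: M_def)
    show "Q r' m'" if "?I (length R) r' m'" for r' m'
      using Q[of r'] that r unfolding max_end_def M_def by simp
    show "r' 10 < r' stop \<longleftrightarrow> k < length R" if "k \<le> length R" "?I k r' m'" for k r' m'
    proof -
      have "r' stop = r stop" using that(2) regs by auto
      then show ?thesis using that r by simp
    qed
    show "length R * (7 + 2) + 2 \<le> t" using t by simp
    fix k r' m' assume k: "k < length R" and I: "?I k r' m'"
    define z where "z = snd (snd (R ! k))"
    have M_Suc: "M (Suc k) = max z (M k)"
      unfolding M_def using k by (simp add: take_Suc_conv_app_nth z_def insert_commute[of 0])
    have r': "r' 0 = 0" "r' 1 = 1" "r' 2 = 3" "r' 10 = p + 3 * k" "r' dst = M k" "m' = m"
      using I r regs by auto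
    let ?c = "cond dst 13 (block [Add dst 13 0]) (block [])"
    let ?r = "r'(12 := p + 3 * k + 2, 13 := z)"
    have mz: "m (p + 3 * k + 2) = z" using m k by (simp add: represents_def z_def)
    have fin: "wp (block [Add 10 10 2]) 1 (?I (Suc k)) r'' m"
      if "\<forall>i. i \<notin> {10, 12, 13, dst} \<longrightarrow> r'' i = r i" "r'' 10 = p + 3 * k" "r'' dst = M (Suc k)" for r''
      by (rule wp_block) (use that r regs in auto)
    have "wp (?c ;; block [Add 10 10 2]) 4 (?I (Suc k)) ?r m"
    proof (rule wp_seq[where t = 3 and u = 1], rule wp_cond[where t = 1])
      assume lt: "?r dst < ?r 13"
      have "wp (block [Add 10 10 2]) 1 (?I (Suc k)) (?r(dst := z)) m"
        by (rule fin) (use I r' regs M_Suc lt in \<open>auto simp: max_def\<close>)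
      then show "wp (block [Add dst 13 0]) 1 (wp (block [Add 10 10 2]) 1 (?I (Suc k))) ?r m"
        by (intro wp_block) (use r' in simp_all)
    next
      assume ge: "\<not> ?r dst < ?r 13"
      have "wp (block [Add 10 10 2]) 1 (?I (Suc k)) ?r m"
        by (rule fin) (use I r' regs M_Suc ge in \<open>auto simp: max_def\<close>)
      then show "wp (block []) 1 (wp (block [Add 10 10 2]) 1 (?I (Suc k))) ?r m"
        by (intro wp_block) simp_all
    qed simp_all
    then show "wp (block [Add 12 10 1, Add 12 12 1, Load 13 12] ;; ?c ;; block [Add 10 10 2]) 7 (?I (Suc k)) r' m'"
      by (intro wp_seq[where t = 3 and u = 4] wp_block) (use r' r'(2)[simplified] mz in simp_all)
  qed
qed

text \<open>Inverts the colour list: cell \<open>X + v\<close> receives the address of the record of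
  vertex \<open>v\<close>, so each interval finds its colours in constant time.\<close>

definition index :: code where
  "index = loop 15 16 (block [Load 20 15, Add 20 20 9, Store 20 15, Add 15 15 2])"

lemma wp_index:
  assumes r: "r 2 = 3" "r 9 = X" "r 15 = p" "r 16 = p + 3 * n"
    and R: "compact_representation c {..<n} E R" and m: "represents m p R" and p: "p + 3 * n \<le> X"
    and Q: "\<And>r' m'. (\<forall>i. i \<notin> {15, 20} \<longrightarrow> r' i = r i) \<Longrightarrow> (\<forall>y. y < X \<or> X + n \<le> y \<longrightarrow> m' y = m y) \<Longrightarrow>
      (\<forall>i<n. m' (X + fst (R ! i)) = p + 3 * i) \<Longrightarrow> Q r' m'"
    and t: "n * 6 + 2 \<le> t"
  shows "wp index t Q r m"
proof -
  note len = compact_representation_length[OF R]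
  let ?I = "\<lambda>k r' m'. (\<forall>i. i \<notin> {15, 20} \<longrightarrow> r' i = r i) \<and> r' 15 = p + 3 * k \<and>
    (\<forall>y. y < X \<or> X + n \<le> y \<longrightarrow> m' y = m y) \<and> (\<forall>i<k. m' (X + fst (R ! i)) = p + 3 * i)"
  show ?thesis
    unfolding index_def
  proof (rule wp_loop[where I = ?I and N = n])
    show "?I 0 r m" using r by simp
    show "Q r' m'" if "?I n r' m'" for r' m' using Q that by blast
    show "r' 15 < r' 16 \<longleftrightarrow> k < n" if "k \<le> n" "?I k r' m'" for k r' m'
      using that r by simp
    show "n * (4 + 2) + 2 \<le> t" using t by simp
    fix k r' m' assume k: "k < n" and I: "?I k r' m'"
    let ?v = "fst (R ! k)"
    have v: "?v < n" using compact_representation_nth(1)[OF R k] .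
    have "m (p + 3 * k) = ?v" using m k len by (simp add: represents_def)
    then have mv: "m' (p + 3 * k) = ?v" using I p k by simp
    have distinct: "fst (R ! i) \<noteq> ?v" if "i < k" for i
      using compact_representation_inj(1)[OF R] k that by (auto simp: inj_on_def)
    show "wp (block [Load 20 15, Add 20 20 9, Store 20 15, Add 15 15 2]) 4 (?I (Suc k)) r' m'"
      by (rule wp_block) (use I r mv v distinct in \<open>auto simp: less_Suc_eq ac_simps\<close>)
  qed
qed

text \<open>Repeated doubling from \<open>n + 2\<close> fills the cells \<open>X + n\<close> to
  \<open>X + n + c\<close>. For \<open>c \<le> n\<close> they end below the table base
  \<open>X + n + n + 1\<close>. One further doubling gives the table size in register 25.\<close>

definition powers :: code where
  "powers = block [Add 21 9 3, Add 22 21 0, Add 23 21 19, Add 24 5 0, Store 22 24] ;;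
     loop 22 23 (block [Add 24 24 24, Add 22 22 1, Store 22 24]) ;;
     block [Add 25 24 24, Add 26 21 3, Add 26 26 1, Const 27 1]"

lemma wp_powers:
  assumes r: "r 0 = 0" "r 1 = 1" "r 3 = n" "r 5 = n + 2" "r 9 = X" "r 19 = c"
    and Q: "\<And>r' m'. (\<forall>i<21. r' i = r i) \<Longrightarrow> r' 21 = X + n \<Longrightarrow> r' 25 = 2 ^ Suc c * (n + 2) \<Longrightarrow>
      r' 26 = X + n + n + 1 \<Longrightarrow> r' 27 = 1 \<Longrightarrow> (\<forall>y. y < X + n \<or> X + n + c < y \<longrightarrow> m' y = m y) \<Longrightarrow>
      (\<forall>j\<le>c. m' (X + n + j) = 2 ^ j * (n + 2)) \<Longrightarrow> Q r' m'"
    and t: "c * 5 + 11 \<le> t"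
  shows "wp powers t Q r m"
proof -
  let ?I = "\<lambda>k r' m'. (\<forall>i<21. r' i = r i) \<and> r' 21 = X + n \<and> r' 22 = X + n + k \<and> r' 23 = X + n + c \<and>
    r' 24 = 2 ^ k * (n + 2) \<and> (\<forall>y. y < X + n \<or> X + n + k < y \<longrightarrow> m' y = m y) \<and>
    (\<forall>j\<le>k. m' (X + n + j) = 2 ^ j * (n + 2))"
  let ?final = "block [Add 25 24 24, Add 26 21 3, Add 26 26 1, Const 27 1]"
  let ?loop = "loop 22 23 (block [Add 24 24 24, Add 22 22 1, Store 22 24])"
  have fin: "wp ?final 4 Q r' m'" if I: "?I c r' m'" for r' m'
  proof (rule wp_block)
    define L where "L = 2 ^ Suc c * (n + 2)"
    have "Q (r'(25 := L, 26 := X + n + n + 1, 27 := 1)) m'"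
      by (rule Q) (use I in \<open>auto simp: L_def\<close>)
    moreover have "r' (Suc 0) = 1" "r' 3 = n" using I r by simp_all
    moreover have "r' 21 = X + n" "r' 24 + r' 24 = L" using I by (simp_all add: L_def)
    ultimately show "case fold exec [Add 25 24 24, Add 26 21 3, Add 26 26 1, Const 27 1] (0, r', m') of
        (_, r', m') \<Rightarrow> Q r' m'"
      by simp
  qed simp_all
  have loop: "wp ?loop (c * 5 + 2) (wp ?final 4 Q) r' m'" if "?I 0 r' m'" for r' m'
  proof (rule wp_loop[where I = ?I and N = c])
    show "?I 0 r' m'" by (rule that)
    show "wp ?final 4 Q r' m'" if "?I c r' m'" for r' m' by (rule fin[OF that])
    show "r' 22 < r' 23 \<longleftrightarrow> k < c" if "k \<le> c" "?I k r' m'" for k r' m' using that by simp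
    show "c * (3 + 2) + 2 \<le> c * 5 + 2" by simp
    fix k r' m' assume I: "?I k r' m'"
    then have "r' 1 = 1" using r by simp
    then show "wp (block [Add 24 24 24, Add 22 22 1, Store 22 24]) 3 (?I (Suc k)) r' m'"
      by (intro wp_block) (use I in \<open>auto simp: le_Suc_eq algebra_simps\<close>)
  qed
  have "wp (?loop ;; ?final) (c * 5 + 6) Q r' m'" if "?I 0 r' m'" for r' m'
    by (rule wp_seq[OF loop[OF that]]) simp
  then show ?thesis
    unfolding powers_def using t
    by (intro wp_seq[where t = 5 and u = "c * 5 + 6"] wp_block) (use r in simp_all)
qed

text \<open>The full mask in row \<open>n + 1\<close> is the last cell of the table, reached from
  its size by adding \<open>n + 1\<close> and subtracting \<open>n + 2\<close>. Register 0, the zero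
  constant so far, is overwritten only now.\<close>

definition answer :: code where
  "answer = block [Add 29 26 6, Add 29 29 25, Sub 29 29 5, Load 30 29] ;;
     cond 30 4 (block [Const 0 0]) (block [Const 0 1])"

lemma wp_answer:
  assumes "r 26 = B" "r 6 = n + 1" "r 25 = 2 ^ Suc c * (n + 2)" "r 5 = n + 2" "r 4 = k"
    "m (B + (2 ^ Suc c - 1) * (n + 2) + Suc n) = z"
  shows "wp answer 7 (\<lambda>r m. r 0 = (if k \<le> z then 1 else 0)) r m"
proof -
  define y where "y = r 26 + r 6 + r 25 - r 5"
  have "(2 ^ Suc c - 1) * (n + 2) + (n + 2) = 2 ^ Suc c * (n + 2)"
    by (metis add_mult_distrib le_add_diff_inverse2 mult_1 one_le_numeral one_le_power)
  then have "y = B + (2 ^ Suc c - 1) * (n + 2) + Suc n" unfolding y_def assms by linarith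
  then have my: "m y = z" using assms by simp
  have "wp (cond 30 4 (block [Const 0 0]) (block [Const 0 1])) 3 (\<lambda>r m. r 0 = (if k \<le> z then 1 else 0))
      (r(29 := y, 30 := z)) m"
    by (intro wp_cond[where t = 1] wp_block) (use assms(5) in auto)
  moreover have "fold exec [Add 29 26 6, Add 29 29 25, Sub 29 29 5, Load 30 29] (0, r, m) =
      (4, r(29 := y, 30 := z), m)"
    by (simp add: y_def[symmetric] my)
  ultimately show ?thesis
    unfolding answer_def by (intro wp_seq[where t = 4 and u = 3] wp_block) simp_all
qed

context representation_pair
begin

lemma wp_solve:
  assumes r: "r 0 = 0" "r 1 = 1" "r 2 = 3" "r 3 = n" "r 4 = k" "r 5 = n + 2" "r 6 = n + 1" "r 9 = X"
      "r 15 = pA" "r 16 = pA + 3 * n" "r 17 = pB" "r 18 = pB + 3 * n" "r 19 = max_end RA"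
    and m: "represents m pA RA" "represents m pB RB" "\<And>y. X \<le> y \<Longrightarrow> m y = 0"
    and X: "pA + 3 * n \<le> X" "pB + 3 * n \<le> X" and cn: "max_end RA \<le> n"
    and t: "(n * 6 + 2) + (max_end RA * 5 + 11) + (102 * 2 ^ max_end RA * n + 2) + 7 \<le> t"
  shows "wp (index ;; powers ;; sweep ;; answer) t
    (\<lambda>r m. r 0 = (if two_union_independent_set {..<n} EA EB k then 1 else 0)) r m"
proof -
  let ?Q = "\<lambda>r m. r 0 = (if two_union_independent_set {..<n} EA EB k then 1 else (0::nat))"
  let ?c = "max_end RA"
  note len = compact_representation_length[OF RA] compact_representation_length[OF RB]
  have main: "wp (sweep ;; answer) ((102 * 2 ^ ?c * n + 2) + 7) ?Q r2 m2"
    if r1: "\<forall>i. i \<notin> {15, 20} \<longrightarrow> r1 i = r i" and m1: "\<forall>y. y < X \<or> X + n \<le> y \<longrightarrow> m1 y = m y"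
      "\<forall>i<n. m1 (X + fst (RA ! i)) = pA + 3 * i"
      and r2: "\<forall>i<21. r2 i = r1 i" "r2 21 = X + n" "r2 25 = 2 ^ Suc ?c * (n + 2)"
      "r2 26 = X + n + n + 1" "r2 27 = 1"
      and m2: "\<forall>y. y < X + n \<or> X + n + ?c < y \<longrightarrow> m2 y = m1 y" "\<forall>j\<le>?c. m2 (X + n + j) = 2 ^ j * (n + 2)"
    for r1 m1 r2 m2
  proof -
    have low: "m2 y = m y" if "y < X" for y using m1 m2 that by simp
    have repA: "represents m2 pA RA" by (rule represents_cong[OF m(1)]) (use low X len in simp)
    have repB: "represents m2 pB RB" by (rule represents_cong[OF m(2)]) (use low X len in simp)
    interpret sweep_memory n ?c "\<lambda>i. fst (snd (RB ! i))" "\<lambda>i. snd (snd (RB ! i))"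
      "\<lambda>i. fst (snd (RA ! partner i))" "\<lambda>i. snd (snd (RA ! partner i))"
      "X + n + n + 1" pB X "X + n" "\<lambda>i. fst (RB ! i)" "\<lambda>i. pA + 3 * partner i" r2 m2
    proof
      show "r2 0 = 0" "r2 1 = 1" "r2 2 = 3" "r2 5 = n + 2" "r2 6 = n + 1" "r2 9 = X" "r2 18 = pB + 3 * n"
        "r2 21 = X + n" "r2 25 = 2 ^ Suc ?c * (n + 2)" "r2 26 = X + n + n + 1"
        using r r1 r2 by simp_all
      show "pB + 3 * n \<le> X + n + n + 1" "X + n + ?c < X + n + n + 1" using X cn by simp_all
      show "m2 (X + n + j) = 2 ^ j * (n + 2)" if "j \<le> ?c" for j using m2 that by simp
      fix i assume i: "i < n"
      have v: "fst (RB ! i) < n" using compact_representation_nth(1)[OF RB i] .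
      then show "X + fst (RB ! i) < X + n + n + 1" by simp
      show "pA + 3 * partner i + 2 < X + n + n + 1" using partner(1)[OF i] X by simp
      show "m2 (pB + 3 * i) = fst (RB ! i)" "m2 (pB + 3 * i + 1) = fst (snd (RB ! i))"
        "m2 (pB + 3 * i + 2) = snd (snd (RB ! i))"
        using repB i len by (simp_all add: represents_def)
      show "m2 (pA + 3 * partner i + 1) = fst (snd (RA ! partner i))"
        "m2 (pA + 3 * partner i + 2) = snd (snd (RA ! partner i))"
        using repA partner(1)[OF i] len by (simp_all add: represents_def)
      show "m2 (X + fst (RB ! i)) = pA + 3 * partner i"
        using m1(2) m2(1) v partner[OF i] by (metis add_less_cancel_left)
    qed
    have st: "state 1 0 (\<lambda>_ _. 0) r2 m2"
      unfolding state_def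
    proof (intro conjI)
      \<comment> \<open>The table lies beyond the input, the vertex index and the powers, so its
        cells still hold the initial zeros that \<open>table_init\<close> asks for.\<close>
      show "stored (X + n + n + 1) m2 (\<lambda>_ _. 0)"
        using m1 m2 m(3) cn by (simp add: stored_def)
      show "r2 17 = pB + 3 * 0" using r r1 r2 by simp
    qed (use r2 table_init in auto)
    show ?thesis
    proof (rule wp_seq[where t = "102 * 2 ^ ?c * n + 2" and u = 7], rule wp_sweep[OF st])
      fix T r3 m3 assume st: "state (Suc n) n T r3 m3"
      have tab: "table (Suc n) n T" using st unfolding state_def by blast
      have val: "m3 (X + n + n + 1 + (2 ^ Suc ?c - 1) * (n + 2) + Suc n) = T (Suc n) (2 ^ Suc ?c - 1)"
      proof -
        have "stored (X + n + n + 1) m3 T" using st unfolding state_def by blast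
        moreover have "(2::nat) ^ Suc ?c - 1 < 2 ^ Suc ?c" by simp
        ultimately show ?thesis unfolding stored_def by blast
      qed
      have "r3 4 = k" using st r r1 r2 unfolding state_def by simp
      from wp_answer[where m = m3 and z = "T (Suc n) (2 ^ Suc ?c - 1)", OF state_regs(10)[OF st] state_regs(5)[OF st] state_regs(9)[OF st] state_regs(4)[OF st] this val]
      show "wp answer 7 ?Q r3 m3" unfolding two_union_iff_table[OF tab] .
    qed simp_all
  qed
  have pow: "wp (powers ;; sweep ;; answer) ((?c * 5 + 11) + ((102 * 2 ^ ?c * n + 2) + 7)) ?Q r1 m1"
    if "\<forall>i. i \<notin> {15, 20} \<longrightarrow> r1 i = r i" "\<forall>y. y < X \<or> X + n \<le> y \<longrightarrow> m1 y = m y"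
      "\<forall>i<n. m1 (X + fst (RA ! i)) = pA + 3 * i" for r1 m1
  proof (rule wp_seq[where t = "?c * 5 + 11" and u = "(102 * 2 ^ ?c * n + 2) + 7"], rule wp_powers[where c = ?c])
    fix r2 m2
    assume "\<forall>i<21. r2 i = r1 i" "r2 21 = X + n" "r2 25 = 2 ^ Suc ?c * (n + 2)"
      "r2 26 = X + n + n + 1" "r2 27 = 1" "\<forall>y. y < X + n \<or> X + n + ?c < y \<longrightarrow> m2 y = m1 y"
      "\<forall>j\<le>?c. m2 (X + n + j) = 2 ^ j * (n + 2)"
    from main[OF that this] show "wp (sweep ;; answer) ((102 * 2 ^ ?c * n + 2) + 7) ?Q r2 m2" .
  qed (use that r in simp_all)
  show ?thesis
  proof (rule wp_seq[where t = "n * 6 + 2" and u = "(?c * 5 + 11) + ((102 * 2 ^ ?c * n + 2) + 7)"],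
      rule wp_index[OF _ _ _ _ RA])
    fix r1 m1
    assume "\<forall>i. i \<notin> {15, 20} \<longrightarrow> r1 i = r i" "\<forall>y. y < X \<or> X + n \<le> y \<longrightarrow> m1 y = m y"
      "\<forall>i<n. m1 (X + fst (RA ! i)) = pA + 3 * i"
    from pow[OF this]
    show "wp (powers ;; sweep ;; answer) ((?c * 5 + 11) + ((102 * 2 ^ ?c * n + 2) + 7)) ?Q r1 m1" .
  qed (use r m X t in \<open>simp_all add: algebra_simps\<close>)
qed

end

section \<open>Assembling the program and its time bound\<close>

definition setup_code :: code where
  "setup_code = block [Const 1 1, Const 2 3, Load 3 0, Load 4 1, Add 6 3 1, Add 5 6 1, Const 7 2, Add 8 3 3,
     Add 8 8 3, Add 9 8 8, Add 8 8 7, Add 9 9 7, Add 10 7 0]"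

text \<open>The list with the smaller largest end point becomes the colour side (registers 15, 16,
  19), the other the position side (17, 18). Only this choice puts the minimum of the two into the
  exponent.\<close>

definition select :: code where
  "select = cond 11 14 (block [Add 15 7 0, Add 16 8 0, Add 17 8 0, Add 18 9 0, Add 19 11 0])
     (block [Add 15 8 0, Add 16 9 0, Add 17 7 0, Add 18 8 0, Add 19 14 0])"

definition two_union_code :: code where
  "two_union_code = setup_code ;; max_end_code 8 11 ;; max_end_code 9 14 ;; select ;;
     index ;; powers ;; sweep ;; answer"

lemma encode_memory:
  assumes "length R1 = n" "length R2 = n"
    and m: "m = (\<lambda>a. if a < length (encode n k R1 R2) then encode n k R1 R2 ! a else 0)"
  shows "m 0 = n" "m 1 = k" "represents m 2 R1" "represents m (2 + 3 * n) R2" "2 + 6 * n \<le> y \<Longrightarrow> m y = 0"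
proof -
  show "m 0 = n" "m 1 = k" by (simp_all add: m encode_def)
  have 1: "m (2 + a) = encode_representation R1 ! a" if "a < 3 * n" for a
    using that assms by (simp add: encode_def nth_append)
  show "represents m 2 R1"
    unfolding represents_def
  proof (intro allI impI)
    fix i assume "i < length R1"
    then show "m (2 + 3 * i) = fst (R1 ! i) \<and> m (2 + 3 * i + 1) = fst (snd (R1 ! i)) \<and>
        m (2 + 3 * i + 2) = snd (snd (R1 ! i))"
      using 1[of "3 * i"] 1[of "3 * i + 1"] 1[of "3 * i + 2"] nth_encode_representation[of i R1] assms(1)
      by (simp only: add.assoc; simp)
  qed
  have 2: "m (2 + 3 * n + a) = encode_representation R2 ! a" if "a < 3 * n" for a
    using that assms by (simp add: encode_def nth_append)
  show "represents m (2 + 3 * n) R2"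
    unfolding represents_def
  proof (intro allI impI)
    fix i assume "i < length R2"
    then show "m (2 + 3 * n + 3 * i) = fst (R2 ! i) \<and> m (2 + 3 * n + 3 * i + 1) = fst (snd (R2 ! i)) \<and>
        m (2 + 3 * n + 3 * i + 2) = snd (snd (R2 ! i))"
      using 2[of "3 * i"] 2[of "3 * i + 1"] 2[of "3 * i + 2"] nth_encode_representation[of i R2] assms(2)
      by (simp only: add.assoc; simp)
  qed
  show "2 + 6 * n \<le> y \<Longrightarrow> m y = 0" using assms by (simp add: encode_def)
qed

lemma wp_two_union:
  assumes R1: "compact_representation c1 {..<n} E1 R1" "c1 \<le> n"
    and R2: "compact_representation c2 {..<n} E2 R2" "c2 \<le> n"
    and m: "m 0 = n" "m 1 = k" "represents m 2 R1" "represents m (2 + 3 * n) R2"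
      "\<And>y. 2 + 6 * n \<le> y \<Longrightarrow> m y = 0"
    and t: "200 * (2 ^ min (max_end R1) (max_end R2) * max 1 n) \<le> t"
  shows "wp two_union_code t
    (\<lambda>r m. r 0 = (if two_union_independent_set {..<n} E1 E2 k then 1 else 0)) (\<lambda>_. 0) m"
proof -
  let ?Q = "\<lambda>r m. r 0 = (if two_union_independent_set {..<n} E1 E2 k then 1 else (0::nat))"
  let ?rest = "index ;; powers ;; sweep ;; answer"
  define c where "c = min (max_end R1) (max_end R2)"
  define u where "u = (n * 6 + 2) + (c * 5 + 11) + (102 * 2 ^ c * n + 2) + 7"
  note len = compact_representation_length[OF R1(1)] compact_representation_length[OF R2(1)]
  have ends: "max_end R1 \<le> n" "max_end R2 \<le> n"
    using max_end_le_compactness[OF R1(1)] max_end_le_compactness[OF R2(1)] R1(2) R2(2) by simp_all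
  interpret P12: representation_pair n c1 c2 E1 E2 R1 R2 by unfold_locales (use R1 R2 in auto)
  interpret P21: representation_pair n c2 c1 E2 E1 R2 R1 by unfold_locales (use R1 R2 in auto)
  define r0 where "r0 = (\<lambda>_ :: nat. 0 :: nat)(1 := 1, 2 := 3, 3 := n, 4 := k, 6 := n + 1, 5 := n + 2, 7 := 2,
    8 := 2 + 3 * n, 9 := 2 + 6 * n, 10 := 2)"
  have r0: "r0 0 = 0" "r0 1 = 1" "r0 2 = 3" "r0 3 = n" "r0 4 = k" "r0 5 = n + 2" "r0 6 = n + 1" "r0 7 = 2"
    "r0 8 = 2 + 3 * n" "r0 9 = 2 + 6 * n" "r0 10 = 2" "r0 11 = 0" "r0 14 = 0"
    by (simp_all add: r0_def)
  have sel: "wp (select ;; ?rest) (7 + u) ?Q r m"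
    if r: "\<forall>i<10. r i = r0 i" "r 11 = max_end R1" "r 14 = max_end R2" for r
  proof -
    have R: "r 0 = 0" "r 1 = 1" "r 2 = 3" "r 3 = n" "r 4 = k" "r 5 = n + 2" "r 6 = n + 1" "r 7 = 2"
      "r 8 = 2 + 3 * n" "r 9 = 2 + 6 * n" using r(1) r0 by simp_all
    show ?thesis
      unfolding select_def
    proof (rule wp_seq[where t = 7 and u = u], rule wp_cond[where t = 5])
      assume "r 11 < r 14"
      then have c: "c = max_end R1" using r by (simp add: c_def)
      let ?r = "r(15 := 2, 16 := 2 + 3 * n, 17 := 2 + 3 * n, 18 := 2 + 6 * n, 19 := max_end R1)"
      have "wp ?rest u ?Q ?r m"
        by (rule P12.wp_solve[where X = "2 + 6 * n" and pA = 2 and pB = "2 + 3 * n"])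
          (use R m ends in \<open>simp_all add: u_def c\<close>)
      then show "wp (block [Add 15 7 0, Add 16 8 0, Add 17 8 0, Add 18 9 0, Add 19 11 0]) 5 (wp ?rest u ?Q) r m"
        by (intro wp_block) (use R r in simp_all)
    next
      assume "\<not> r 11 < r 14"
      then have c: "c = max_end R2" using r by (simp add: c_def)
      let ?r = "r(15 := 2 + 3 * n, 16 := 2 + 6 * n, 17 := 2, 18 := 2 + 3 * n, 19 := max_end R2)"
      have comm: "two_union_independent_set {..<n} E1 E2 k = two_union_independent_set {..<n} E2 E1 k"
        by (simp add: two_union_independent_set_def Un_commute)
      have "wp ?rest u ?Q ?r m"
        unfolding comm
        by (rule P21.wp_solve[where X = "2 + 6 * n" and pB = 2 and pA = "2 + 3 * n"])
          (use R m ends in \<open>simp_all add: u_def c\<close>)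
      then show "wp (block [Add 15 8 0, Add 16 9 0, Add 17 7 0, Add 18 8 0, Add 19 14 0]) 5 (wp ?rest u ?Q) r m"
        by (intro wp_block) (use R r in simp_all)
    qed simp_all
  qed
  have second: "wp (max_end_code 9 14 ;; select ;; ?rest) ((n * 9 + 2) + (7 + u)) ?Q r m"
    if r: "\<forall>i<10. r i = r0 i" "r 10 = 2 + 3 * n" "r 11 = max_end R1" "r 14 = 0" for r
  proof (rule wp_seq[OF wp_max_end[where t = "n * 9 + 2" and R = R2 and p = "2 + 3 * n"]])
    fix r' assume r': "\<forall>i. i \<notin> {10, 12, 13, 14} \<longrightarrow> r' i = r i" "r' 14 = max_end R2"
    show "wp (select ;; ?rest) (7 + u) ?Q r' m" by (rule sel) (use r r' in auto)
  qed (use r r0 len m in simp_all)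
  have first: "wp (max_end_code 8 11 ;; max_end_code 9 14 ;; select ;; ?rest)
      ((n * 9 + 2) + ((n * 9 + 2) + (7 + u))) ?Q r0 m"
  proof (rule wp_seq[OF wp_max_end[where t = "n * 9 + 2" and R = R1 and p = 2]])
    fix r' assume r': "\<forall>i. i \<notin> {10, 12, 13, 11} \<longrightarrow> r' i = r0 i" "r' 10 = r0 8" "r' 11 = max_end R1"
    show "wp (max_end_code 9 14 ;; select ;; ?rest) ((n * 9 + 2) + (7 + u)) ?Q r' m"
      by (rule second) (use r0 r' in auto)
  qed (use r0 len m in simp_all)
  have "fold exec [Const 1 1, Const 2 3, Load 3 0, Load 4 1, Add 6 3 1, Add 5 6 1, Const 7 2, Add 8 3 3,
     Add 8 8 3, Add 9 8 8, Add 8 8 7, Add 9 9 7, Add 10 7 0] (0, \<lambda>_. 0, m) = (13, r0, m)"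
    using m by (auto simp: r0_def fun_eq_iff)
  with first have "wp two_union_code (13 + ((n * 9 + 2) + ((n * 9 + 2) + (7 + u)))) ?Q (\<lambda>_. 0) m"
    unfolding two_union_code_def setup_code_def
    by (intro wp_seq[where t = 13 and u = "(n * 9 + 2) + ((n * 9 + 2) + (7 + u))"] wp_block) simp_all
  then show ?thesis
  proof (rule wp_mono)
    \<comment> \<open>\<open>max 1 n\<close> absorbs the constant steps when \<open>n = 0\<close>.
      The total \<open>102 * (2 ^ c * n) + 24 * n + 5 * c + 46\<close> is at most
      \<open>177 * N\<close>, rounded up to 200.\<close>
    define N :: nat where "N = 2 ^ c * max 1 n"
    have "(1::nat) \<le> 2 ^ c" by simp
    then have "1 * max 1 n \<le> N" "2 ^ c * 1 \<le> N" unfolding N_def by (intro mult_le_mono; simp)+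
    moreover have "c \<le> 2 ^ c" using less_exp[of c] by simp
    moreover have "2 ^ c * n \<le> N" by (simp add: N_def)
    moreover have "1 \<le> max 1 n" "n \<le> max 1 n" by simp_all
    ultimately have "1 \<le> N" "n \<le> N" "c \<le> N" "2 ^ c * n \<le> N" by linarith+
    moreover have "102 * 2 ^ c * n = 102 * (2 ^ c * n)" by simp
    ultimately have "13 + ((n * 9 + 2) + ((n * 9 + 2) + (7 + u))) \<le> 200 * N"
      unfolding u_def by linarith
    then show "13 + ((n * 9 + 2) + ((n * 9 + 2) + (7 + u))) \<le> t" using t by (simp add: N_def c_def)
  qed
qed

theorem theorem7:
  "\<exists>(P :: program) (C :: nat). \<forall>(n :: nat) (k :: nat) (E1 :: nat set set) (E2 :: nat set set) R1 R2.
     interval_graph {..<n} E1 \<longrightarrow> interval_graph {..<n} E2 \<longrightarrow>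
     compact_representation (compactness {..<n} E1) {..<n} E1 R1 \<longrightarrow>
     compact_representation (compactness {..<n} E2) {..<n} E2 R2 \<longrightarrow>
     decides_within P (encode n k R1 R2)
       (two_union_independent_set {..<n} E1 E2 k)
       (C * (2 ^ c_exists {..<n} E1 E2 * max 1 n))"
proof (intro exI[of _ "two_union_code 0"] exI[of _ 200] allI impI)
  fix n k :: nat and E1 E2 :: "nat set set" and R1 R2
  assume R: "compact_representation (compactness {..<n} E1) {..<n} E1 R1"
    "compact_representation (compactness {..<n} E2) {..<n} E2 R2"
  note len = compact_representation_length[OF R(1)] compact_representation_length[OF R(2)]
  \<comment> \<open>Either graph may become the position side, so both need their coordinates
    bounded by \<open>n\<close>.\<close>
  have c: "compactness {..<n} E1 \<le> n" "compactness {..<n} E2 \<le> n"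
    using R[THEN compactness_le_length] len by simp_all
  have m: "snd (snd (initial (encode n k R1 R2))) =
      (\<lambda>a. if a < length (encode n k R1 R2) then encode n k R1 R2 ! a else 0)"
    by (simp add: initial_def)
  show "decides_within (two_union_code 0) (encode n k R1 R2) (two_union_independent_set {..<n} E1 E2 k)
     (200 * (2 ^ c_exists {..<n} E1 E2 * max 1 n))"
  proof (rule wp_decides)
    show "wp two_union_code (200 * (2 ^ min (max_end R1) (max_end R2) * max 1 n))
        (\<lambda>r m. r 0 = (if two_union_independent_set {..<n} E1 E2 k then 1 else 0)) (\<lambda>_. 0)
        (snd (snd (initial (encode n k R1 R2))))"
      by (rule wp_two_union[OF R(1) c(1) R(2) c(2) encode_memory[OF len m] order_refl])
    show "200 * (2 ^ min (max_end R1) (max_end R2) * max 1 n) \<le> 200 * (2 ^ c_exists {..<n} E1 E2 * max 1 n)"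
      by (intro mult_le_mono power_increasing min_max_end_le_c_exists R) simp_all
  qed
qed

end
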